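(* Assume the family $\{f_t\}_t$ is Newton-admissible. Then, in a sufficiently small neighbourhood of the origin, the canonical toric stratification $\mathcal{S}$ of $V(f)$ satisfies Thom's $a_f$ condition: for every stratum $S\in\mathcal{S}$, every point $(\tau,\mathbf{q})\in S$, and every sequence $(\tau_m,\mathbf{q}_m)\notin V(f)$ with $(\tau_m,\mathbf{q}_m)\to(\tau,\mathbf{q})$ and such that the tangent spaces $T_{(\tau_m,\mathbf{q}_m)}V(f-f(\tau_m,\mathbf{q}_m))$ converge to some $T$ (in the appropriate Grassmannian), one has $T_{(\tau,\mathbf{q})}S\subseteq T$.
   Context: Let $(t,\mathbf{z})=(t,z_1,\ldots,z_n)$ be coordinates on $\mathbb{C}\times\mathbb{C}^n$. For $k\in K_0:=\{1,\ldots,k_0\}$ let $f^k\colon\mathbb{C}\times\mathbb{C}^n\to\mathbb{C}$ be a non-constant polynomial with $f^k(t,\mathbf{0})=0$ for all $t$; put $f:=f^1\cdots f^{k_0}$, $f_t(\mathbf{z}):=f(t,\mathbf{z})$, $f^k_t(\mathbf{z}):=f^k(t,\mathbf{z})$. All statements concern germs at the origin; a small representative is chosen so that $0$ is the only possible critical value of $f$, and $V(f-c):=\{(t,\mathbf z): f(t,\mathbf z)=c\}$. Newton data: for a polynomial $g(\mathbf{z})=\sum_\alpha c_\alpha\mathbf{z}^\alpha$ with $g(\mathbf{0})=0$, $\Gamma_+(g)$ is the convex hull in $\mathbb{R}^n_+$ of $\bigcup_{c_\alpha\neq0}(\alpha+\mathbb{R}^n_+)$, and the Newton boundary $\Gamma(g)$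 is the union of its compact faces. For a weight vector $\mathbf{w}=(w_1,\ldots,w_n)\in\mathbb{N}^n\setminus\{\mathbf{0}\}$ (nonnegative integers), $d(\mathbf{w};g):=\min\{\sum_i w_ix_i : x\in\Gamma_+(g)\}$, $\Delta(\mathbf{w};g)$ is the face of $\Gamma_+(g)$ where this minimum is attained, $g_{\mathbf{w}}:=\sum_{\alpha\in\Delta(\mathbf{w};g)}c_\alpha\mathbf{z}^\alpha$ is the face function, and $I(\mathbf{w}):=\{i: w_i=0\}$. $\mathbf w$ is positive if all $w_i>0$. For $I\subseteq\{1,\ldots,n\}$, $\mathbb{C}^I:=\{\mathbf{z}: z_i=0 \text{ for } i\notin I\}$ and $\mathbb{C}^{*I}:=\{\mathbf{z}: z_i=0\iff i\notin I\}$; $\mathbb{C}^{*n}=\mathbb{C}^{*\{1,\ldots,n\}}$. $\mathcal{V}_g$ is the set of $I$ with $g|_{\mathbb{C}^I}\equiv0$. For $i_1,\ldots,i_m$ and $u_{i_j}\in\mathbb{C}^*$, $\mathbb{C}^{*n}(u_{i_1},\ldots,u_{i_m}):=\{\mathbf{z}\in\mathbb{C}^{*n}: z_{i_j}=u_{i_j},\ 1\le j\le m\}$. Non-degenerate complete intersection: polynomials $g^1,\ldots,g^p$ vanishing at $\mathbf 0$ define a non-degenerate complete intersection germ $V(g^1,\ldots,g^p)$ if for every positive weight vector $\mathbf{w}$, the $p$-form $dg^1_{\mathbf{w}}\wedge\cdots\wedge dg^p_{\mathbf{w}}$ is nowhere zero on $V^*(g^1_{\mathbf{w}},\ldots,g^p_{\mathbf{w}}):=\{\mathbf{z}\in\mathbb{C}^{*n}: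 g^1_{\mathbf{w}}(\mathbf{z})=\cdots=g^p_{\mathbf{w}}(\mathbf{z})=0\}$. Local tameness: $R>0$ is a radius of local tameness of $\{g^1,\ldots,g^p\}$ if for every nonempty $I=\{i_1,\ldots,i_m\}\in\mathcal{V}_{g^1}\cap\cdots\cap\mathcal{V}_{g^p}$, every $\mathbf{w}\in\mathbb{N}^n\setminus\{\mathbf 0\}$ with $I(\mathbf{w})=I$ and every $u_{i_1},\ldots,u_{i_m}\in\mathbb{C}^*$ with $\sum_j|u_{i_j}|^2<R$, the set $V^*(g^1_{\mathbf{w}},\ldots,g^p_{\mathbf{w}})\cap\mathbb{C}^{*n}(u_{i_1},\ldots,u_{i_m})$ is a reduced non-singular complete intersection in $\mathbb{C}^{*n}(u_{i_1},\ldots,u_{i_m})$, i.e. the differentials of $g^1_{\mathbf{w}},\ldots,g^p_{\mathbf{w}}$ with respect to the variables $(z_i)_{i\notin I}$ are linearly independent at each of its points; the germ is locally tame if such $R$ exists. Newton-admissible: $\{f_t\}_t$ is Newton-admissible if there is $R>0$ such that for all sufficiently small $t$: (i) for each $k\in K_0$, $\Gamma(f^k_t)$ is independent of $t$; (ii) for every nonempty $\{k_1,\ldots,k_p\}\subseteq K_0$, $V(f^{k_1}_t,\ldots,f^{k_p}_t)$ is a non-degenerate, locally tame complete intersection germ having a radius of local tameness greater than $R$ ($R$ independent of $t$ and of the subset). Canonical toric stratification: $\mathcal{S}$ is the collection of nonempty sets $S^I(K):=\{(t,\mathbf{z})\in\mathbb{C}\times\mathbb{C}^{*I}: f^k(t,\mathbf{z})=0\iff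 k\in K\}$ for $I\subseteq\{1,\ldots,n\}$, $K\subseteq K_0$ (near the origin these are non-singular, and $S^{\emptyset}(K_0)=\mathbb{C}\times\{\mathbf 0\}$). *)

theory Defs
  imports "HOL-Analysis.Analysis"
begin

text \<open>Points of C x C^n are pairs (t, z) with z :: complex^'n.
  A polynomial in (t, z) is a finitely supported coefficient function on
  exponents (j, alpha) with j :: nat (exponent of t) and alpha :: nat^'n.
  A polynomial in z alone is a coefficient function on alpha :: nat^'n.\<close>

type_synonym 'n tzpoly = "nat \<times> (nat^'n) \<Rightarrow> complex"
type_synonym 'n zpoly = "nat^'n \<Rightarrow> complex"

definition is_tzpoly :: "'n::finite tzpoly \<Rightarrow> bool" where
  "is_tzpoly P \<longleftrightarrow> finite {e. P e \<noteq> 0}"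

definition tzeval :: "'n::finite tzpoly \<Rightarrow> complex \<times> (complex^'n) \<Rightarrow> complex" where
  "tzeval P x = (\<Sum>e\<in>{e. P e \<noteq> 0}. P e * (fst x) ^ (fst e) * (\<Prod>i\<in>UNIV. ((snd x) $ i) ^ ((snd e) $ i)))"

definition slice :: "'n::finite tzpoly \<Rightarrow> complex \<Rightarrow> 'n zpoly" where
  "slice P t = (\<lambda>\<alpha>. \<Sum>j\<in>{j. P (j, \<alpha>) \<noteq> 0}. P (j, \<alpha>) * t ^ j)"

definition zeval :: "'n::finite zpoly \<Rightarrow> complex^'n \<Rightarrow> complex" where
  "zeval g z = (\<Sum>\<alpha>\<in>{\<alpha>. g \<alpha> \<noteq> 0}. g \<alpha> * (\<Prod>i\<in>UNIV. (z $ i) ^ (\<alpha> $ i)))"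

definition partial :: "'n::finite \<Rightarrow> (complex^'n \<Rightarrow> complex) \<Rightarrow> complex^'n \<Rightarrow> complex" where
  "partial i h z = deriv (\<lambda>s. h (\<chi> j. if j = i then s else z $ j)) (z $ i)"

definition newton_polyhedron :: "'n::finite zpoly \<Rightarrow> (real^'n) set" where
  "newton_polyhedron g =
     convex hull (\<Union>\<alpha>\<in>{\<alpha>. g \<alpha> \<noteq> 0}. {x. \<forall>i. real (\<alpha> $ i) \<le> x $ i})"

definition newton_boundary :: "'n::finite zpoly \<Rightarrow> (real^'n) set" where
  "newton_boundary g = \<Union>{F. F face_of newton_polyhedron g \<and> compact F}"

definition wdeg :: "nat^'n::finite \<Rightarrow> 'n zpoly \<Rightarrow> real" where
  "wdeg w g = Inf {(\<Sum>i\<in>UNIV. real (w $ i) * x $ i) | x. x \<in> newton_polyhedron g}"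

definition wface :: "nat^'n::finite \<Rightarrow> 'n zpoly \<Rightarrow> (real^'n) set" where
  "wface w g = {x \<in> newton_polyhedron g. (\<Sum>i\<in>UNIV. real (w $ i) * x $ i) = wdeg w g}"

definition face_fun :: "nat^'n::finite \<Rightarrow> 'n zpoly \<Rightarrow> 'n zpoly" where
  "face_fun w g = (\<lambda>\<alpha>. if (\<chi> i. real (\<alpha> $ i)) \<in> wface w g then g \<alpha> else 0)"

definition cindep_on :: "'n::finite set \<Rightarrow> 'k set \<Rightarrow> ('k \<Rightarrow> complex^'n) \<Rightarrow> bool" where
  "cindep_on J K v \<longleftrightarrow>
     (\<forall>c :: 'k \<Rightarrow> complex. (\<forall>i\<in>J. (\<Sum>k\<in>K. c k * (v k $ i)) = 0) \<longrightarrow> (\<forall>k\<in>K. c k = 0))"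

definition face_grad :: "nat^'n::finite \<Rightarrow> 'n zpoly \<Rightarrow> complex^'n \<Rightarrow> complex^'n" where
  "face_grad w g z = (\<chi> i. partial i (zeval (face_fun w g)) z)"

definition torus :: "(complex^'n::finite) set" where
  "torus = {z. \<forall>i. z $ i \<noteq> 0}"

definition nondegenerate :: "'k set \<Rightarrow> ('k \<Rightarrow> 'n::finite zpoly) \<Rightarrow> bool" where
  "nondegenerate K G \<longleftrightarrow>
     (\<forall>w :: nat^'n. (\<forall>i. 0 < w $ i) \<longrightarrow>
        (\<forall>z\<in>torus. (\<forall>k\<in>K. zeval (face_fun w (G k)) z = 0) \<longrightarrow>
           cindep_on UNIV K (\<lambda>k. face_grad w (G k) z)))"

definition vanishes_on_coord :: "'n::finite zpoly \<Rightarrow> 'n set \<Rightarrow> bool" where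
  "vanishes_on_coord g I \<longleftrightarrow> (\<forall>z. (\<forall>i. i \<notin> I \<longrightarrow> z $ i = 0) \<longrightarrow> zeval g z = 0)"

text \<open>R is a radius of local tameness of {g^k, k in K}.  A point z of the torus with
  z_i = u_i (i in I) is parametrised directly by z.\<close>
definition tame_radius :: "'k set \<Rightarrow> ('k \<Rightarrow> 'n::finite zpoly) \<Rightarrow> real \<Rightarrow> bool" where
  "tame_radius K G R \<longleftrightarrow>
     (\<forall>I :: 'n set. I \<noteq> {} \<and> (\<forall>k\<in>K. vanishes_on_coord (G k) I) \<longrightarrow>
        (\<forall>w :: nat^'n. w \<noteq> 0 \<and> {i. w $ i = 0} = I \<longrightarrow>
          (\<forall>z\<in>torus. (\<Sum>i\<in>I. (cmod (z $ i))\<^sup>2) < R \<and>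
              (\<forall>k\<in>K. zeval (face_fun w (G k)) z = 0) \<longrightarrow>
              cindep_on (- I) K (\<lambda>k. face_grad w (G k) z))))"

definition newton_admissible :: "nat \<Rightarrow> (nat \<Rightarrow> 'n::finite tzpoly) \<Rightarrow> bool" where
  "newton_admissible k0 F \<longleftrightarrow>
     (\<exists>R>0. \<exists>\<epsilon>>0. \<forall>t. cmod t < \<epsilon> \<longrightarrow>
        (\<forall>k\<in>{1..k0}. newton_boundary (slice (F k) t) = newton_boundary (slice (F k) 0)) \<and>
        (\<forall>K. K \<noteq> {} \<and> K \<subseteq> {1..k0} \<longrightarrow>
            nondegenerate K (\<lambda>k. slice (F k) t) \<and>
            (\<exists>R'. R' > R \<and> tame_radius K (\<lambda>k. slice (F k) t) R')))"

definition fprod :: "nat \<Rightarrow> (nat \<Rightarrow> 'n::finite tzpoly) \<Rightarrow> complex \<times> (complex^'n) \<Rightarrow> complex" where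
  "fprod k0 F x = (\<Prod>k\<in>{1..k0}. tzeval (F k) x)"

definition toric_stratum :: "nat \<Rightarrow> (nat \<Rightarrow> 'n::finite tzpoly) \<Rightarrow> 'n set \<Rightarrow> nat set
    \<Rightarrow> (complex \<times> (complex^'n)) set" where
  "toric_stratum k0 F I K =
     {(t, z). (\<forall>i. z $ i = 0 \<longleftrightarrow> i \<notin> I) \<and> (\<forall>k\<in>{1..k0}. tzeval (F k) (t, z) = 0 \<longleftrightarrow> k \<in> K)}"

text \<open>Tangent space of a set at a point (tangent cone; it is the usual tangent space
  at non-singular points).\<close>
definition tangent_space :: "'a::real_normed_vector set \<Rightarrow> 'a \<Rightarrow> 'a set" where
  "tangent_space S p =
     {v. \<exists>x :: nat \<Rightarrow> 'a. \<exists>c :: nat \<Rightarrow> real. (\<forall>m. x m \<in> S \<and> c m > 0) \<and>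
          x \<longlonglongrightarrow> p \<and> (\<lambda>m. c m *\<^sub>R (x m - p)) \<longlonglongrightarrow> v}"

definition cscale :: "complex \<Rightarrow> complex \<times> (complex^'n::finite) \<Rightarrow> complex \<times> (complex^'n)" where
  "cscale c x = (c * fst x, \<chi> i. c * (snd x $ i))"

definition grassmannian_hyp :: "(complex \<times> (complex^'n::finite)) set set" where
  "grassmannian_hyp = {T. subspace T \<and> (\<forall>v\<in>T. cscale \<i> v \<in> T) \<and> dim T = 2 * CARD('n)}"

text \<open>Gap metric between linear subspaces (induces the Grassmannian topology).\<close>
definition subspace_gap :: "'a::real_normed_vector set \<Rightarrow> 'a set \<Rightarrow> real" where
  "subspace_gap A B =
     max (SUP v\<in>A \<inter> sphere 0 1. infdist v B) (SUP v\<in>B \<inter> sphere 0 1. infdist v A)"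

definition subspaces_converge :: "(nat \<Rightarrow> 'a::real_normed_vector set) \<Rightarrow> 'a set \<Rightarrow> bool" where
  "subspaces_converge Ts T \<longleftrightarrow> (\<lambda>m. subspace_gap (Ts m) T) \<longlonglongrightarrow> 0"

end

theory Submission
  imports Defs
begin

text \<open>
  Instead of curve selection and analytic arcs, the proof works directly with sequences.  Along a
  subsequence of \<open>x\<^sub>m \<rightarrow> p = (\<tau>, q)\<close>, the logarithms of the moduli of the coordinates are
  asymptotically comparable on every difference of exponents that occurs.  This yields an integer
  weight \<open>w\<close> (zero exactly where \<open>q\<^sub>i \<noteq> 0\<close>), a torus point \<open>b\<close>, and scales \<open>N\<^sub>k\<close> such that
  \<open>f\<^sup>k / N\<^sub>k\<close> and \<open>z\<^sub>i \<partial>\<^sub>i f\<^sup>k / N\<^sub>k\<close> converge to the values at \<open>b\<close> of the face function \<open>f\<^sup>k\<^sub>w\<close> and its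
  logarithmic derivatives.

  Put \<open>\<omega> = \<Sum>\<^sub>k df\<^sup>k / f\<^sup>k\<close>, a conormal of the level set, and divide \<open>\<omega>\<close>, the numbers \<open>N\<^sub>k / f\<^sup>k\<close> and 1 by
  a common bound \<open>M\<close>.  In the limit, the image of 1 vanishes (by Euler's identity if some \<open>f\<^sup>k\<close>
  vanishes identically on the coordinate subspace of the stratum).  Then local tameness (or
  non-degeneracy, if \<open>q = 0\<close>) kills the limit coefficients of those \<open>f\<^sup>k\<close>.  The remaining limit covector
  is a combination of the \<open>df\<^sup>k(p)\<close> with \<open>f\<^sup>k(p) = 0\<close> that cut out the stratum inside its coordinate
  subspace.  It is nonzero because these are independent near the origin, which follows from
  non-degeneracy by the same degeneration.
\<close>

section \<open>Tropical degeneration of sequences\<close>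

text \<open>Induction on the finite set \<open>A\<close>: each new element costs one further
  subsequence, and \<open>sub\<close> preserves the properties already secured.\<close>

lemma finite_common_subseq:
  assumes "finite A"
    and ex: "\<And>a s. a \<in> A \<Longrightarrow> strict_mono (s :: nat \<Rightarrow> nat) \<Longrightarrow> \<exists>r :: nat \<Rightarrow> nat. strict_mono r \<and> Q a (s \<circ> r)"
    and sub: "\<And>a s r. a \<in> A \<Longrightarrow> Q a s \<Longrightarrow> strict_mono (r :: nat \<Rightarrow> nat) \<Longrightarrow> Q a (s \<circ> r)"
  obtains r where "strict_mono r" "\<forall>a\<in>A. Q a r"
proof -
  have "\<exists>r. strict_mono r \<and> (\<forall>a\<in>B. Q a r)" if "finite B" "B \<subseteq> A" for B
    using that
  proof (induction B)
    case empty
    show ?case using strict_mono_id by blast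
  next
    case (insert a B)
    then obtain s where s: "strict_mono s" "\<forall>b\<in>B. Q b s" by auto
    with insert ex[of a s] obtain r where r: "strict_mono r" "Q a (s \<circ> r)" by auto
    have "\<forall>b\<in>insert a B. Q b (s \<circ> r)" using s r insert sub by auto
    then show ?case using strict_mono_o[OF s(1) r(1)] by blast
  qed
  with assms(1) that show ?thesis by blast
qed

text \<open>The extended real line is compact; a finite or infinite limit point gives the three
  alternatives.\<close>

lemma real_seq_extended_subseq:
  fixes X :: "nat \<Rightarrow> real"
  obtains r where "strict_mono r"
    "convergent (X \<circ> r) \<or> filterlim (X \<circ> r) at_top sequentially \<or> filterlim (X \<circ> r) at_bot sequentially"
proof -
  obtain l and r :: "nat \<Rightarrow> nat" where r: "strict_mono r" and l: "((\<lambda>m. ereal (X m)) \<circ> r) \<longlonglongrightarrow> l"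
    using compact_complete_linorder[of "\<lambda>m. ereal (X m)"] by blast
  have "convergent (X \<circ> r) \<or> filterlim (X \<circ> r) at_top sequentially \<or> filterlim (X \<circ> r) at_bot sequentially"
  proof (cases l)
    case (real x)
    then show ?thesis using l by (auto simp: convergent_def o_def)
  next
    case PInf
    then show ?thesis using l by (auto simp: o_def tendsto_PInfty_eq_at_top)
  next
    case MInf
    have "filterlim (\<lambda>m. - X (r m)) at_top sequentially"
      using l MInf tendsto_uminus_ereal[of "\<lambda>m. ereal (X (r m))" l sequentially]
      by (simp add: o_def flip: tendsto_PInfty_eq_at_top)
    then show ?thesis by (simp add: o_def filterlim_uminus_at_bot)
  qed
  then show ?thesis using r that by blast
qed

text \<open>By Dirichlet some multiple \<open>q v\<close> is within \<open>\<epsilon>\<close> of an integer point \<open>w\<close>.  As the values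
  \<open>w \<bullet> d\<close> are integers, those with \<open>v \<bullet> d = 0\<close> vanish exactly.\<close>
lemma integer_vector_same_signs:
  fixes v :: "real^'n"
  assumes "finite D" and D: "\<And>d i. d \<in> D \<Longrightarrow> d $ i \<in> \<int>"
  obtains w :: "real^'n" where "\<And>i. w $ i \<in> \<int>" "\<And>d. d \<in> D \<Longrightarrow> sgn (w \<bullet> d) = sgn (v \<bullet> d)"
proof -
  \<comment> \<open>\<open>C\<close> exceeds the l1 norm of every \<open>d\<close>, so a coordinate
    error of at most \<open>1 / N\<close> changes the inner product with \<open>d\<close> by at most
    \<open>C / N\<close>.\<close>
  define C where "C = 1 + (\<Sum>d\<in>D. \<Sum>i\<in>UNIV. \<bar>d $ i\<bar>)"
  have C1: "C \<ge> 1" unfolding C_def by (simp add: sum_nonneg)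
  have dC: "(\<Sum>i\<in>UNIV. \<bar>d $ i\<bar>) < C" if "d \<in> D" for d
  proof -
    have "(\<Sum>i\<in>UNIV. \<bar>d $ i\<bar>) \<le> (\<Sum>d\<in>D. \<Sum>i\<in>UNIV. \<bar>d $ i\<bar>)"
      by (rule member_le_sum[OF that]) (auto simp: sum_nonneg assms)
    then show ?thesis by (simp add: C_def)
  qed
  \<comment> \<open>\<open>m\<close> is the least nonzero value of
    \<open>\<bar>v \<bullet> d\<bar>\<close>, capped at 1. An error below \<open>m\<close> cannot
    change the sign of a nonzero \<open>q * (v \<bullet> d)\<close>, and by the cap an integer that
    approximates 0 must be 0.\<close>
  define m where "m = Min (insert 1 ((\<lambda>d. \<bar>v \<bullet> d\<bar>) ` {d\<in>D. v \<bullet> d \<noteq> 0}))"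
  have m0: "0 < m" unfolding m_def using assms(1) by (subst Min_gr_iff) auto
  have mle: "m \<le> \<bar>v \<bullet> d\<bar>" if "d \<in> D" "v \<bullet> d \<noteq> 0" for d
    unfolding m_def using that assms(1) by (intro Min_le) auto
  have m1: "m \<le> 1" unfolding m_def using assms(1) by (intro Min_le) auto
  obtain N :: nat where N: "C / m < real N" using reals_Archimedean2 by blast
  have N0: "N > 0" using N C1 m0 by (intro gr0I) (simp add: divide_less_0_iff)
  obtain h where h: "bij_betw h (UNIV :: 'n set) {0..<CARD('n)}"
    using ex_bij_betw_finite_nat[of "UNIV :: 'n set"] by auto
  define g where "g = inv_into UNIV h"
  have gh: "g (h i) = i" for i using h by (simp add: g_def bij_betw_def)
  obtain q p where q: "0 < q" and qp: "\<And>i. i < CARD('n) \<Longrightarrow> \<bar>of_int q * (v $ g i) - of_int (p i)\<bar> < 1 / N"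
    using Dirichlet_approx_simult[OF N0, of "CARD('n)" "\<lambda>i. v $ g i"] by metis
  define w where "w = (\<chi> i. real_of_int (p (h i)))"
  have close: "\<bar>of_int q * v $ i - w $ i\<bar> < 1 / N" for i
  proof -
    have "h i < CARD('n)" using bij_betw_apply[OF h, of i] by simp
    then show ?thesis using qp[of "h i"] by (simp add: w_def gh)
  qed
  have diff: "\<bar>of_int q * (v \<bullet> d) - w \<bullet> d\<bar> < m" if "d \<in> D" for d
  proof -
    have "\<bar>of_int q * (v \<bullet> d) - w \<bullet> d\<bar> = \<bar>\<Sum>i\<in>UNIV. (of_int q * v $ i - w $ i) * d $ i\<bar>"
      by (simp add: inner_vec_def sum_distrib_left sum_subtractf algebra_simps)
    also have "\<dots> \<le> (\<Sum>i\<in>UNIV. \<bar>(of_int q * v $ i - w $ i) * d $ i\<bar>)" by (rule sum_abs)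
    also have "\<dots> \<le> (\<Sum>i\<in>UNIV. (1 / N) * \<bar>d $ i\<bar>)"
      by (intro sum_mono, unfold abs_mult, intro mult_right_mono less_imp_le[OF close]) auto
    also have "\<dots> = (1 / N) * (\<Sum>i\<in>UNIV. \<bar>d $ i\<bar>)" by (simp add: sum_distrib_left)
    also have "\<dots> \<le> (1 / N) * C" using dC[OF that] by (intro mult_left_mono) auto
    also have "\<dots> < m" using N N0 m0 by (simp add: pos_divide_less_eq mult.commute)
    finally show ?thesis .
  qed
  have int: "w \<bullet> d \<in> \<int>" if "d \<in> D" for d
    using D[OF that] by (auto simp: inner_vec_def w_def intro!: Ints_sum Ints_mult)
  have "sgn (w \<bullet> d) = sgn (v \<bullet> d)" if d: "d \<in> D" for d
  proof (cases "v \<bullet> d = 0")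
    case True
    then have "\<bar>w \<bullet> d\<bar> < 1" using diff[OF d] m1 by simp
    then have "w \<bullet> d = 0" using int[OF d] Ints_nonzero_abs_less1 by blast
    then show ?thesis using True by simp
  next
    case False
    have "\<bar>v \<bullet> d\<bar> \<le> \<bar>of_int q * (v \<bullet> d)\<bar>" using q by (simp add: abs_mult mult_le_cancel_right1)
    with mle[OF d False] have "m \<le> \<bar>of_int q * (v \<bullet> d)\<bar>" by simp
    with diff[OF d] m0 have "sgn (w \<bullet> d) = sgn (of_int q * (v \<bullet> d))"
      by (smt (verit) sgn_neg sgn_pos)
    then show ?thesis using q by (simp add: sgn_mult)
  qed
  then show ?thesis using that[of w] by (simp add: w_def)
qed

text \<open>Sequential form of tropical degeneration: \<open>\<rho> m\<close> is minus the part of \<open>L (r m)\<close> orthogonal to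
  all \<open>d \<in> D\<close> on which \<open>L \<circ> r\<close> converges.\<close>
lemma tropical_subseq:
  fixes L :: "nat \<Rightarrow> real^'n"
  assumes "finite D" and D: "\<And>d i. d \<in> D \<Longrightarrow> d $ i \<in> \<int>"
  obtains r :: "nat \<Rightarrow> nat" and \<rho> l w where "strict_mono r" "(\<lambda>m. L (r m) + \<rho> m) \<longlonglongrightarrow> l"
    "\<forall>i. w $ i \<in> \<int>"
    "\<forall>d\<in>D. w \<bullet> d = 0 \<longrightarrow> (\<forall>m. \<rho> m \<bullet> d = 0) \<and> convergent (\<lambda>m. L (r m) \<bullet> d)"
    "\<forall>d\<in>D. w \<bullet> d > 0 \<longrightarrow> filterlim (\<lambda>m. \<rho> m \<bullet> d) at_top sequentially \<and> filterlim (\<lambda>m. L (r m) \<bullet> d) at_bot sequentially"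
    "\<forall>d\<in>D. w \<bullet> d < 0 \<longrightarrow> filterlim (\<lambda>m. \<rho> m \<bullet> d) at_bot sequentially \<and> filterlim (\<lambda>m. L (r m) \<bullet> d) at_top sequentially"
proof -
  define Q where "Q d s \<longleftrightarrow> convergent (\<lambda>m. L (s m) \<bullet> d) \<or> filterlim (\<lambda>m. L (s m) \<bullet> d) at_top sequentially
      \<or> filterlim (\<lambda>m. L (s m) \<bullet> d) at_bot sequentially" for d and s :: "nat \<Rightarrow> nat"
  obtain r where r: "strict_mono r" and Q: "\<forall>d\<in>D. Q d r"
  proof (rule finite_common_subseq[OF assms(1), of Q])
    fix d and s :: "nat \<Rightarrow> nat"
    show "\<exists>r. strict_mono r \<and> Q d (s \<circ> r)"
      by (rule real_seq_extended_subseq[of "\<lambda>m. L (s m) \<bullet> d"]) (auto simp: Q_def o_def)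
  next
    fix d and s r :: "nat \<Rightarrow> nat" assume *: "Q d s" "strict_mono r"
    note r = filterlim_subseq[OF *(2)]
    show "Q d (s \<circ> r)"
      using *(1) filterlim_compose[OF _ r] convergent_subseq_convergent[OF _ *(2)]
      unfolding Q_def o_def by blast
  qed
  define V where "V = span {d\<in>D. convergent (\<lambda>m. L (r m) \<bullet> d)}"
  have conv: "convergent (\<lambda>m. L (r m) \<bullet> v)" if "v \<in> V" for v
    using that unfolding V_def
  proof (induction rule: span_induct)
    case base
    show ?case
      by (auto simp: subspace_def inner_add_right convergent_const intro!: convergent_add convergent_mult)
  qed auto
  obtain B where B: "B \<subseteq> V" "pairwise orthogonal B" "\<And>x. x \<in> B \<Longrightarrow> norm x = 1" "independent B" "span B = V"
    using orthonormal_basis_subspace[of V] by (metis V_def subspace_span)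
  have finB: "finite B" using B(4) by (rule independent_imp_finite)
  \<comment> \<open>\<open>P\<close> is the orthogonal projection onto \<open>V\<close>; it
    converges along \<open>L \<circ> r\<close> since the pairings with the basis do. Hence
    \<open>\<rho>\<close> will be orthogonal to \<open>V\<close>, and its other pairings are those
    of \<open>L\<close> negated, up to a convergent error.\<close>
  define P where "P x = (\<Sum>b\<in>B. (x \<bullet> b) *\<^sub>R b)" for x
  have Pb: "P x \<bullet> b = x \<bullet> b" if "b \<in> B" for x b
  proof -
    have "P x \<bullet> b = (\<Sum>b'\<in>B. if b' = b then x \<bullet> b else 0)"
      unfolding P_def inner_sum_left using B(2,3) that
      by (intro sum.cong) (auto simp: pairwise_def orthogonal_def dot_square_norm)
    then show ?thesis using that finB by simp
  qed
  have Pv: "P x \<bullet> v = x \<bullet> v" if "v \<in> V" for x v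
    using that unfolding B(5)[symmetric]
  proof (induction rule: span_induct)
    case base
    show ?case by (auto simp: subspace_def inner_add_right)
  qed (use Pb in auto)
  have "convergent (\<lambda>m. P (L (r m)))"
    unfolding P_def 
    proof (intro convergent_sum)
    fix b assume "b \<in> B"
    then obtain c where "(\<lambda>m. L (r m) \<bullet> b) \<longlonglongrightarrow> c" using conv B(1) by (auto simp: convergent_def)
    then have "(\<lambda>m. (L (r m) \<bullet> b) *\<^sub>R b) \<longlonglongrightarrow> c *\<^sub>R b" by (intro tendsto_intros)
    then show "convergent (\<lambda>m. (L (r m) \<bullet> b) *\<^sub>R b)" by (auto simp: convergent_def)
  qed
  then obtain l where l: "(\<lambda>m. P (L (r m))) \<longlonglongrightarrow> l" by (auto simp: convergent_def)
  define \<rho> where "\<rho> m = P (L (r m)) - L (r m)" for m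
  have rho0: "\<rho> m \<bullet> d = 0" if "d \<in> D" "convergent (\<lambda>m. L (r m) \<bullet> d)" for d m
  proof -
    have "d \<in> V" using that by (auto simp: V_def intro: span_base)
    then show ?thesis using Pv by (simp add: \<rho>_def inner_diff_left)
  qed
  have Pl: "(\<lambda>m. P (L (r m)) \<bullet> d) \<longlonglongrightarrow> l \<bullet> d" for d by (intro tendsto_intros l)
  have rhobot: "filterlim (\<lambda>m. \<rho> m \<bullet> d) at_bot sequentially" if "filterlim (\<lambda>m. L (r m) \<bullet> d) at_top sequentially" for d
    using filterlim_tendsto_add_at_top[OF tendsto_minus[OF Pl[of d]] that]
    by (simp add: \<rho>_def inner_diff_left filterlim_uminus_at_bot)
  have rhotop: "filterlim (\<lambda>m. \<rho> m \<bullet> d) at_top sequentially" if "filterlim (\<lambda>m. L (r m) \<bullet> d) at_bot sequentially" for d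
    using filterlim_tendsto_add_at_top[OF Pl[of d], of "\<lambda>m. - (L (r m) \<bullet> d)"] that
    by (simp add: \<rho>_def inner_diff_left filterlim_uminus_at_bot)
  \<comment> \<open>A single late index \<open>m0\<close> suffices: there all divergent pairings
    have their eventual sign and the convergent ones are 0, so the real vector
    \<open>\<rho> m0\<close> already has the sign pattern required of \<open>w\<close>.\<close>
  have "\<forall>d\<in>D. eventually (\<lambda>m. (filterlim (\<lambda>m. L (r m) \<bullet> d) at_top sequentially \<longrightarrow> \<rho> m \<bullet> d < 0) \<and>
       (filterlim (\<lambda>m. L (r m) \<bullet> d) at_bot sequentially \<longrightarrow> \<rho> m \<bullet> d > 0)) sequentially"
    using rhobot rhotop by (auto intro!: eventually_conj simp: filterlim_at_top_dense filterlim_at_bot_dense)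
  then have "eventually (\<lambda>m. \<forall>d\<in>D. (filterlim (\<lambda>m. L (r m) \<bullet> d) at_top sequentially \<longrightarrow> \<rho> m \<bullet> d < 0) \<and>
       (filterlim (\<lambda>m. L (r m) \<bullet> d) at_bot sequentially \<longrightarrow> \<rho> m \<bullet> d > 0)) sequentially"
    using assms(1) by (simp add: eventually_ball_finite)
  then obtain m0 where m0: "\<And>d. d \<in> D \<Longrightarrow> filterlim (\<lambda>m. L (r m) \<bullet> d) at_top sequentially \<Longrightarrow> \<rho> m0 \<bullet> d < 0"
     "\<And>d. d \<in> D \<Longrightarrow> filterlim (\<lambda>m. L (r m) \<bullet> d) at_bot sequentially \<Longrightarrow> \<rho> m0 \<bullet> d > 0"
    using eventually_happens'[OF sequentially_bot] by blast
  obtain w where w: "\<And>i. w $ i \<in> \<int>" "\<And>d. d \<in> D \<Longrightarrow> sgn (w \<bullet> d) = sgn (\<rho> m0 \<bullet> d)"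
    using integer_vector_same_signs[OF assms] by metis
  have cases: "(w \<bullet> d = 0 \<and> convergent (\<lambda>m. L (r m) \<bullet> d)) \<or>
      (w \<bullet> d < 0 \<and> filterlim (\<lambda>m. L (r m) \<bullet> d) at_top sequentially) \<or>
      (w \<bullet> d > 0 \<and> filterlim (\<lambda>m. L (r m) \<bullet> d) at_bot sequentially)" if "d \<in> D" for d
    using Q that m0[OF that] rho0[OF that] w(2)[OF that] unfolding Q_def
    by (metis sgn_0_0 sgn_greater sgn_less)
  show ?thesis
  proof (rule that[of r \<rho> l w])
    show "(\<lambda>m. L (r m) + \<rho> m) \<longlonglongrightarrow> l" using l by (simp add: \<rho>_def)
    show "\<forall>d\<in>D. w \<bullet> d = 0 \<longrightarrow> (\<forall>m. \<rho> m \<bullet> d = 0) \<and> convergent (\<lambda>m. L (r m) \<bullet> d)"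
      "\<forall>d\<in>D. w \<bullet> d > 0 \<longrightarrow> filterlim (\<lambda>m. \<rho> m \<bullet> d) at_top sequentially \<and> filterlim (\<lambda>m. L (r m) \<bullet> d) at_bot sequentially"
      "\<forall>d\<in>D. w \<bullet> d < 0 \<longrightarrow> filterlim (\<lambda>m. \<rho> m \<bullet> d) at_bot sequentially \<and> filterlim (\<lambda>m. L (r m) \<bullet> d) at_top sequentially"
      using cases rho0 rhobot rhotop by fastforce+
  qed (use r w(1) in auto)
qed

section \<open>Monomials, weights and their asymptotics along a sequence\<close>

definition zmon :: "complex^'n::finite \<Rightarrow> nat^'n \<Rightarrow> complex" where
  "zmon z \<alpha> = (\<Prod>i\<in>UNIV. (z $ i) ^ (\<alpha> $ i))"

definition wt :: "nat^'n::finite \<Rightarrow> nat^'n \<Rightarrow> nat" where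
  "wt w \<alpha> = (\<Sum>i\<in>UNIV. w $ i * \<alpha> $ i)"

definition rvec :: "nat^'n::finite \<Rightarrow> real^'n" where
  "rvec \<alpha> = (\<chi> i. real (\<alpha> $ i))"

lemma zmon_eq_0_iff: "zmon z \<alpha> = 0 \<longleftrightarrow> (\<exists>i. z $ i = 0 \<and> \<alpha> $ i \<noteq> 0)"
  by (auto simp: zmon_def)

lemma tendsto_zmon [tendsto_intros]:
  "(f \<longlongrightarrow> z) A \<Longrightarrow> ((\<lambda>x. zmon (f x) \<alpha>) \<longlongrightarrow> zmon z \<alpha>) A"
  unfolding zmon_def by (intro tendsto_intros)

lemma finite_range_const_subseq:
  fixes f :: "nat \<Rightarrow> 'a"
  assumes "finite (range f)"
  obtains c s where "strict_mono (s :: nat \<Rightarrow> nat)" "\<And>m. f (s m) = c"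
proof -
  obtain m0 where "infinite {m. f m = f m0}"
    using pigeonhole_infinite[OF infinite_UNIV_nat assms] by auto
  from infinite_enumerate[OF this] show ?thesis using that by auto
qed

text \<open>All vanishing coordinates are replaced by one positive real \<open>e\<close>. As
  \<open>e\<close> tends to 0, the finitely many monomials that vanish at \<open>y\<close> tend to
  0, so a single \<open>e\<close> meets all the bounds.\<close>

lemma fill_zeros:
  fixes y :: "complex^'n"
  assumes "finite E" "c > 0"
  obtains u where "\<And>i. u $ i \<noteq> 0" "\<And>i. y $ i \<noteq> 0 \<Longrightarrow> u $ i = y $ i" "\<And>i. y $ i = 0 \<Longrightarrow> norm (u $ i) < c"
    "\<And>\<alpha>. \<alpha> \<in> E \<Longrightarrow> zmon y \<alpha> = 0 \<Longrightarrow> norm (zmon u \<alpha>) < c"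
proof -
  define fl where "fl e = (\<chi> i. if y $ i = 0 then complex_of_real e else y $ i)" for e :: real
  have lim: "(fl \<longlongrightarrow> y) (at_right 0)"
  proof (rule vec_tendstoI)
    fix i
    have "((\<lambda>e. complex_of_real e) \<longlongrightarrow> of_real 0) (at_right 0)" by (intro tendsto_intros)
    then show "((\<lambda>e. fl e $ i) \<longlongrightarrow> y $ i) (at_right 0)" by (cases "y $ i = 0") (auto simp: fl_def)
  qed
  have "eventually (\<lambda>e. norm (zmon (fl e) \<alpha>) < c) (at_right 0)" if "zmon y \<alpha> = 0" for \<alpha>
    using tendsto_norm[OF tendsto_zmon[OF lim, of \<alpha>]] that assms(2) by (intro order_tendstoD(2)) auto
  then have "eventually (\<lambda>e. \<forall>\<alpha>\<in>{\<alpha>\<in>E. zmon y \<alpha> = 0}. norm (zmon (fl e) \<alpha>) < c) (at_right 0)"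
    using assms(1) by (intro eventually_ball_finite) auto
  moreover have "eventually (\<lambda>e::real. e > 0) (at_right 0)" by (rule eventually_at_right_less)
  moreover have "eventually (\<lambda>e::real. e < c) (at_right 0)" using assms(2)
    by (meson eventually_at_right_field)
  ultimately have "eventually (\<lambda>e. e > 0 \<and> e < c \<and> (\<forall>\<alpha>\<in>{\<alpha>\<in>E. zmon y \<alpha> = 0}. norm (zmon (fl e) \<alpha>) < c)) (at_right 0)"
    by (intro eventually_conj)
  then obtain e where "e > 0" "e < c" "\<forall>\<alpha>\<in>{\<alpha>\<in>E. zmon y \<alpha> = 0}. norm (zmon (fl e) \<alpha>) < c"
    using eventually_happens'[of "at_right (0::real)"] by auto
  then show ?thesis by (intro that[of "fl e"]) (auto simp: fl_def)
qed

lemma real_wt: "real (wt w \<alpha>) = rvec w \<bullet> rvec \<alpha>"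
  by (simp add: wt_def rvec_def inner_vec_def)

text \<open>The coordinates vanishing along the sequence are first replaced by numbers so small that no
  monomial containing them can become dominant.\<close>
lemma monomial_asymptotics:
  fixes z :: "nat \<Rightarrow> complex^'n" and E :: "(nat^'n) set"
  assumes finE: "finite E" and zq: "z \<longlonglongrightarrow> q"
  obtains r w b where "strict_mono r" "\<And>i. b $ i \<noteq> 0" "\<And>i. w $ i = 0 \<longleftrightarrow> q $ i \<noteq> 0"
    "\<And>i. q $ i \<noteq> 0 \<Longrightarrow> b $ i = q $ i"
    "\<And>S m \<alpha>. S \<subseteq> E \<Longrightarrow> \<alpha> \<in> S \<Longrightarrow> zmon (z (r m)) \<alpha> \<noteq> 0 \<Longrightarrow>
       \<exists>N :: nat \<Rightarrow> real. (\<forall>m. 0 < N m) \<and>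
         (\<forall>\<alpha>\<in>S. (\<lambda>m. zmon (z (r m)) \<alpha> / of_real (N m)) \<longlonglongrightarrow> (if \<forall>\<beta>\<in>S. wt w \<alpha> \<le> wt w \<beta> then zmon b \<alpha> else 0))"
proof -
  \<comment> \<open>Only finitely many zero patterns exist, so along a subsequence the set
    \<open>J\<close> of nonzero coordinates is constant.\<close>
  obtain J s where s: "strict_mono (s :: nat \<Rightarrow> nat)" and J: "\<And>m. {i. z (s m) $ i \<noteq> 0} = J"
    by (rule finite_range_const_subseq[of "\<lambda>m. {i. z m $ i \<noteq> 0}"]) auto
  define y where "y = z \<circ> s"
  have yJ: "y m $ i \<noteq> 0 \<longleftrightarrow> i \<in> J" for m i using J[of m] by (auto simp: y_def)
  have yq: "y \<longlonglongrightarrow> q" unfolding y_def using zq s by (rule LIMSEQ_subseq_LIMSEQ)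
  have ymon: "zmon (y m) \<alpha> = 0 \<longleftrightarrow> (\<exists>i. i \<notin> J \<and> \<alpha> $ i \<noteq> 0)" for m \<alpha>
    using yJ[of m] by (auto simp: zmon_eq_0_iff)
  define EJ where "EJ = {\<alpha>\<in>E. \<forall>i. i \<notin> J \<longrightarrow> \<alpha> $ i = 0}"
  \<comment> \<open>Anything smaller than \<open>c m\<close> is negligible against every surviving
    monomial, by the factor \<open>1 / Suc m\<close>; the entry 1 in the minimum makes the filled-in
    coordinates tend to 0.\<close>
  define c where "c m = Min (insert 1 ((\<lambda>\<beta>. norm (zmon (y m) \<beta>)) ` EJ)) / real (Suc m)" for m
  have finEJ: "finite EJ" using finE by (auto simp: EJ_def)
  have c0: "c m > 0" for m
    unfolding c_def using finEJ by (intro divide_pos_pos) (auto simp: Min_gr_iff ymon EJ_def)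
  have cle: "c m \<le> norm (zmon (y m) \<beta>) / real (Suc m)" if "\<beta> \<in> EJ" for m \<beta>
    unfolding c_def using finEJ that by (intro divide_right_mono Min_le) auto
  have cle1: "c m \<le> 1 / real (Suc m)" for m
    unfolding c_def using finEJ by (intro divide_right_mono Min_le) auto
  have "\<exists>u. \<forall>m. (\<forall>i. u m $ i \<noteq> 0) \<and> (\<forall>i\<in>J. u m $ i = y m $ i) \<and> (\<forall>i. i \<notin> J \<longrightarrow> norm (u m $ i) < c m)
      \<and> (\<forall>\<alpha>\<in>E - EJ. norm (zmon (u m) \<alpha>) < c m)"
  proof (rule choice, rule allI)
    fix m
    obtain u where "\<And>i. u $ i \<noteq> 0" "\<And>i. y m $ i \<noteq> 0 \<Longrightarrow> u $ i = y m $ i" "\<And>i. y m $ i = 0 \<Longrightarrow> norm (u $ i) < c m"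
      "\<And>\<alpha>. \<alpha> \<in> E \<Longrightarrow> zmon (y m) \<alpha> = 0 \<Longrightarrow> norm (zmon u \<alpha>) < c m"
      using fill_zeros[OF finE c0[of m], of "y m"] by metis
    then show "\<exists>u. (\<forall>i. u $ i \<noteq> 0) \<and> (\<forall>i\<in>J. u $ i = y m $ i) \<and> (\<forall>i. i \<notin> J \<longrightarrow> norm (u $ i) < c m)
      \<and> (\<forall>\<alpha>\<in>E - EJ. norm (zmon u \<alpha>) < c m)"
      using yJ[of m] ymon[of m] by (intro exI[of _ u]) (simp add: EJ_def, blast)
  qed
  then obtain u where u0: "\<And>m i. u m $ i \<noteq> 0" and uJ: "\<And>m i. i \<in> J \<Longrightarrow> u m $ i = y m $ i"
    and uc: "\<And>m i. i \<notin> J \<Longrightarrow> norm (u m $ i) < c m"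
    and uE: "\<And>m \<alpha>. \<alpha> \<in> E - EJ \<Longrightarrow> norm (zmon (u m) \<alpha>) < c m" by metis
  have umon: "zmon (u m) \<alpha> = zmon (y m) \<alpha>" if "\<alpha> \<in> EJ" for m \<alpha>
    unfolding zmon_def
  proof (intro prod.cong refl)
    fix i show "u m $ i ^ \<alpha> $ i = y m $ i ^ \<alpha> $ i"
      using that uJ[of i m] by (cases "i \<in> J") (auto simp: EJ_def)
  qed
  have inv0: "(\<lambda>m. 1 / real (Suc m)) \<longlonglongrightarrow> 0" by (rule LIMSEQ_Suc[OF lim_1_over_n])
  have uq: "u \<longlonglongrightarrow> q"
  proof (rule vec_tendstoI)
    fix i
    have yqi: "(\<lambda>m. y m $ i) \<longlonglongrightarrow> q $ i" by (intro tendsto_intros yq)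
    show "(\<lambda>m. u m $ i) \<longlonglongrightarrow> q $ i"
    proof (cases "i \<in> J")
      case True
      then show ?thesis using yqi uJ by simp
    next
      case False
      then have "(\<lambda>m. y m $ i) = (\<lambda>m. 0)" using yJ by auto
      with yqi have "q $ i = 0" by (simp add: LIMSEQ_const_iff)
      moreover have "(\<lambda>m. u m $ i) \<longlonglongrightarrow> 0"
        using uc[OF False] cle1 by (intro Lim_null_comparison[OF _ inv0] always_eventually allI) (metis less_imp_le less_le_trans)
      ultimately show ?thesis by simp
    qed
  qed
  define L where "L m = (\<chi> i. ln (norm (u m $ i)))" for m
  have expL: "exp (L m $ i) = norm (u m $ i)" for m i using u0 by (simp add: L_def)
  \<comment> \<open>Differences of exponents compare two monomials; the unit vectors compare each
    coordinate with 1 and so determine the sign of its weight.\<close>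
  define D where "D = (\<lambda>(\<alpha>, \<beta>). rvec \<alpha> - rvec \<beta>) ` (E \<times> E) \<union> range (\<lambda>i. axis i (1::real))"
  have finD: "finite D" using finE by (simp add: D_def)
  have intD: "d $ i \<in> \<int>" if "d \<in> D" for d i
    using that by (auto simp: D_def rvec_def axis_def)
  obtain r1 \<rho> l wr where r1: "strict_mono (r1 :: nat \<Rightarrow> nat)" and l: "(\<lambda>m. L (r1 m) + \<rho> m) \<longlonglongrightarrow> l"
    and wint: "\<forall>i. wr $ i \<in> \<int>"
    and W0: "\<forall>d\<in>D. wr \<bullet> d = 0 \<longrightarrow> (\<forall>m. \<rho> m \<bullet> d = 0) \<and> convergent (\<lambda>m. L (r1 m) \<bullet> d)"
    and Wp: "\<forall>d\<in>D. wr \<bullet> d > 0 \<longrightarrow> filterlim (\<lambda>m. \<rho> m \<bullet> d) at_top sequentially \<and> filterlim (\<lambda>m. L (r1 m) \<bullet> d) at_bot sequentially"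
    and Wn: "\<forall>d\<in>D. wr \<bullet> d < 0 \<longrightarrow> filterlim (\<lambda>m. \<rho> m \<bullet> d) at_bot sequentially \<and> filterlim (\<lambda>m. L (r1 m) \<bullet> d) at_top sequentially"
    by (rule tropical_subseq[OF finD, of L], erule intD, rule that, assumption+)
  note w0 = W0[rule_format] and wpos = Wp[rule_format] and wneg = Wn[rule_format]
  have axD: "axis i 1 \<in> D" for i by (auto simp: D_def)
  have normq: "(\<lambda>m. exp (L (r1 m) $ i)) \<longlonglongrightarrow> norm (q $ i)" for i
    unfolding expL using LIMSEQ_subseq_LIMSEQ[OF uq r1] by (auto simp: o_def intro!: tendsto_intros)
  have wr_nonneg: "wr $ i \<ge> 0" for i
  proof (rule ccontr)
    assume "\<not> wr $ i \<ge> 0"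
    then have "filterlim (\<lambda>m. L (r1 m) $ i) at_top sequentially"
      using wneg[OF axD[of i]] by (simp add: inner_axis)
    then have "filterlim (\<lambda>m. exp (L (r1 m) $ i)) at_top sequentially"
      by (rule filterlim_compose[OF exp_at_top])
    then show False using normq[of i] not_tendsto_and_filterlim_at_infinity[OF sequentially_bot normq[of i]]
       filterlim_at_top_imp_at_infinity by blast
  qed
  have wr_iff: "wr $ i = 0 \<longleftrightarrow> q $ i \<noteq> 0" for i
  proof
    assume "wr $ i = 0"
    then have "convergent (\<lambda>m. L (r1 m) $ i)" using w0[OF axD[of i]] by (simp add: inner_axis)
    then obtain a where "(\<lambda>m. L (r1 m) $ i) \<longlonglongrightarrow> a" by (auto simp: convergent_def)
    then have "(\<lambda>m. exp (L (r1 m) $ i)) \<longlonglongrightarrow> exp a" by (intro tendsto_intros)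
    then have "norm (q $ i) = exp a" using normq LIMSEQ_unique by blast
    then show "q $ i \<noteq> 0" by auto
  next
    assume q: "q $ i \<noteq> 0"
    show "wr $ i = 0"
    proof (rule ccontr)
      assume "wr $ i \<noteq> 0"
      then have "filterlim (\<lambda>m. L (r1 m) $ i) at_bot sequentially"
        using wpos[OF axD[of i]] wr_nonneg[of i] by (simp add: inner_axis)
      then have "(\<lambda>m. exp (L (r1 m) $ i)) \<longlonglongrightarrow> 0" by (rule filterlim_compose[OF exp_at_bot])
      then show False using normq LIMSEQ_unique q by force
    qed
  qed
  define w :: "nat^'n" where "w = (\<chi> i. nat \<lfloor>wr $ i\<rfloor>)"
  have rw: "rvec w = wr"
    using wint wr_nonneg by (auto simp: rvec_def w_def vec_eq_iff of_int_floor)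
  \<comment> \<open>Polar decomposition: the phases lie in a compact set and converge after a
    further subsequence, while \<open>\<rho>\<close> absorbs the divergence of the moduli.\<close>
  define ph where "ph m = (\<chi> i. u (r1 m) $ i / of_real (norm (u (r1 m) $ i)))" for m
  have nph: "norm (ph m $ i) = 1" for m i using u0 by (simp add: ph_def norm_divide)
  have "norm (ph m) \<le> (\<Sum>i\<in>UNIV. norm (ph m $ i))" for m unfolding norm_vec_def by (rule L2_set_le_sum) auto
  then have "bounded (range ph)" unfolding bounded_iff using nph by auto
  then obtain \<theta> r2 where r2: "strict_mono (r2 :: nat \<Rightarrow> nat)" and \<theta>: "(ph \<circ> r2) \<longlonglongrightarrow> \<theta>"
    using bounded_imp_convergent_subsequence by blast
  have \<theta>i: "(\<lambda>m. ph (r2 m) $ i) \<longlonglongrightarrow> \<theta> $ i" for i using tendsto_vec_nth[OF \<theta>, of i] by (simp add: o_def)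
  have n\<theta>: "norm (\<theta> $ i) = 1" for i
    using tendsto_norm[OF \<theta>i[of i]] by (simp add: nph LIMSEQ_const_iff)
  define k where "k = r1 \<circ> r2"
  have k: "strict_mono k" unfolding k_def using r1 r2 by (rule strict_mono_o)
  define p where "p = \<rho> \<circ> r2"
  \<comment> \<open>\<open>bs\<close> is the filled-in sequence with the factor
    \<open>exp (- p)\<close> removed; it converges to a point \<open>b\<close> with all coordinates
    nonzero.\<close>
  define bs where "bs m = (\<chi> i. ph (r2 m) $ i * of_real (exp (L (k m) $ i + p m $ i)))" for m
  define b where "b = (\<chi> i. \<theta> $ i * of_real (exp (l $ i)))"
  have l2: "(\<lambda>m. L (k m) $ i + p m $ i) \<longlonglongrightarrow> l $ i" for i
    using tendsto_vec_nth[OF LIMSEQ_subseq_LIMSEQ[OF l r2], of i] by (simp add: o_def k_def p_def)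
  have bs: "bs \<longlonglongrightarrow> b"
    by (rule vec_tendstoI) (auto simp: bs_def b_def intro!: tendsto_intros \<theta>i l2)
  have b0: "b $ i \<noteq> 0" for i using n\<theta>[of i] by (auto simp: b_def)
  have u_bs: "u (k m) $ i = bs m $ i * of_real (exp (- p m $ i))" for m i
  proof -
    have "bs m $ i * of_real (exp (- p m $ i)) = ph (r2 m) $ i * of_real (exp (L (k m) $ i + p m $ i) * exp (- p m $ i))"
      by (simp add: bs_def)
    also have "exp (L (k m) $ i + p m $ i) * exp (- p m $ i) = norm (u (k m) $ i)"
      by (simp add: expL flip: exp_add)
    finally show ?thesis using u0 by (simp add: ph_def k_def)
  qed
  have umon_bs: "zmon (u (k m)) \<alpha> = zmon (bs m) \<alpha> * of_real (exp (- (p m \<bullet> rvec \<alpha>)))" for m \<alpha>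
  proof -
    have "of_real (exp (- (p m \<bullet> rvec \<alpha>))) = (\<Prod>i\<in>UNIV. complex_of_real (exp (- p m $ i)) ^ (\<alpha> $ i))"
    proof -
      have "exp (- (a * real n)) = exp (- a) ^ n" for a :: real and n
        using exp_of_nat_mult[of n "- a"] by (simp add: mult.commute)
      then show ?thesis by (simp add: inner_vec_def rvec_def exp_sum flip: sum_negf of_real_power)
    qed
    then show ?thesis by (simp add: zmon_def u_bs power_mult_distrib prod.distrib)
  qed
  have bq: "b $ i = q $ i" if "q $ i \<noteq> 0" for i
  proof -
    have "\<rho> m $ i = 0" for m
      using w0[OF axD[of i]] that wr_iff[of i] by (simp add: inner_axis)
    then have "u (k m) $ i = bs m $ i" for m using u_bs[of m i] by (simp add: p_def)
    then have "(\<lambda>m. u (k m) $ i) \<longlonglongrightarrow> b $ i" using tendsto_vec_nth[OF bs, of i] by simp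
    moreover have "(\<lambda>m. u (k m) $ i) \<longlonglongrightarrow> q $ i"
      using tendsto_vec_nth[OF LIMSEQ_subseq_LIMSEQ[OF uq k], of i] by (simp add: o_def)
    ultimately show ?thesis using LIMSEQ_unique by blast
  qed
  have main: "\<exists>N :: nat \<Rightarrow> real. (\<forall>m. 0 < N m) \<and>
         (\<forall>\<alpha>\<in>S. (\<lambda>m. zmon (y (k m)) \<alpha> / of_real (N m)) \<longlonglongrightarrow> (if \<forall>\<beta>\<in>S. wt w \<alpha> \<le> wt w \<beta> then zmon b \<alpha> else 0))"
    if S: "S \<subseteq> E" "\<gamma> \<in> S" "zmon (y (k m)) \<gamma> \<noteq> 0" for S m \<gamma>
  proof -
    \<comment> \<open>The zero pattern is constant, so a monomial nonzero at one index is nonzero at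
      all of them.\<close>
    have \<gamma>: "\<gamma> \<in> EJ" using S ymon by (auto simp: EJ_def)
    obtain a where a: "a \<in> S" "\<And>\<beta>. \<beta> \<in> S \<Longrightarrow> wt w a \<le> wt w \<beta>"
      using ex_has_least_nat[of "\<lambda>x. x \<in> S" \<gamma> "wt w"] S(2) by auto
    \<comment> \<open>The scale is the order of the filled-in monomials of least weight in
      \<open>S\<close>: after division by it these have nonzero limits and all others tend to
      0.\<close>
    define N :: "nat \<Rightarrow> real" where "N m = exp (- (p m \<bullet> rvec a))" for m
    define lim where "lim \<alpha> = (if \<forall>\<beta>\<in>S. wt w \<alpha> \<le> wt w \<beta> then zmon b \<alpha> else 0)" for \<alpha>
    have ratio: "zmon (u (k m)) \<alpha> / N m = zmon (bs m) \<alpha> * of_real (exp (- (p m \<bullet> (rvec \<alpha> - rvec a))))" for m \<alpha>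
      by (simp add: umon_bs N_def inner_diff_right exp_diff exp_minus field_simps)
    have ulim: "(\<lambda>m. zmon (u (k m)) \<alpha> / N m) \<longlonglongrightarrow> lim \<alpha>" if \<alpha>: "\<alpha> \<in> S" for \<alpha>
    proof -
      have dD: "rvec \<alpha> - rvec a \<in> D" using \<alpha> a S by (auto simp: D_def)
      have wd: "wr \<bullet> (rvec \<alpha> - rvec a) = real (wt w \<alpha>) - real (wt w a)"
        by (simp add: inner_diff_right real_wt rw)
      show ?thesis
      proof (cases "wt w \<alpha> = wt w a")
        case True
        then have "p m \<bullet> (rvec \<alpha> - rvec a) = 0" for m using w0[OF dD] wd by (simp add: p_def)
        then show ?thesis using True a(2) tendsto_zmon[OF bs, of \<alpha>] by (simp add: ratio lim_def)
      next
        case False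
        then have gt: "wt w \<alpha> > wt w a" using a(2)[OF \<alpha>] by simp
        then have "filterlim (\<lambda>m. \<rho> m \<bullet> (rvec \<alpha> - rvec a)) at_top sequentially" using wpos[OF dD] wd by simp
        then have "filterlim (\<lambda>m. p m \<bullet> (rvec \<alpha> - rvec a)) at_top sequentially"
          using filterlim_compose[OF _ filterlim_subseq[OF r2]] by (force simp: p_def o_def)
        then have "(\<lambda>m. exp (- (p m \<bullet> (rvec \<alpha> - rvec a)))) \<longlonglongrightarrow> 0"
          by (intro filterlim_compose[OF exp_at_bot]) (simp add: filterlim_uminus_at_bot)
        then have "(\<lambda>m. zmon (bs m) \<alpha> * of_real (exp (- (p m \<bullet> (rvec \<alpha> - rvec a))))) \<longlonglongrightarrow> zmon b \<alpha> * of_real 0"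
          by (intro tendsto_intros bs)
        moreover have "lim \<alpha> = 0" using gt a(1) by (auto simp: lim_def not_le)
        ultimately show ?thesis by (simp add: ratio)
      qed
    qed
    have "(\<lambda>m. zmon (y (k m)) \<alpha> / N m) \<longlonglongrightarrow> lim \<alpha>" if \<alpha>: "\<alpha> \<in> S" for \<alpha>
    proof (cases "\<alpha> \<in> EJ")
      case True
      then show ?thesis using ulim[OF \<alpha>] by (simp add: umon)
    next
      \<comment> \<open>The exponent uses a coordinate that is zero along \<open>y\<close>. Its
        filled-in monomial is negligible against that of \<open>\<gamma>\<close>, so
        \<open>lim \<alpha>\<close> is 0 and \<open>\<alpha>\<close> does not have least weight.
        This agrees with the true monomial, which is identically 0.\<close>
      case False
      have N0: "N m > 0" for m by (simp add: N_def)
      have bound: "norm (zmon (u (k m)) \<alpha> / N m) \<le> norm (zmon (u (k m)) \<gamma> / N m) * (1 / real (Suc (k m)))" for m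
      proof -
        have le: "norm (zmon (u (k m)) \<alpha>) \<le> norm (zmon (u (k m)) \<gamma>) * (1 / real (Suc (k m)))"
          using uE[of \<alpha> "k m"] cle[OF \<gamma>, of "k m"] S(1) \<alpha> False umon[OF \<gamma>, of "k m"] by auto
        have "norm (zmon (u (k m)) \<alpha> / N m) = norm (zmon (u (k m)) \<alpha>) / N m"
          using N0[of m] by (simp add: norm_divide)
        also have "\<dots> \<le> norm (zmon (u (k m)) \<gamma>) * (1 / real (Suc (k m))) / N m"
          using le less_imp_le[OF N0[of m]] by (rule divide_right_mono)
        also have "\<dots> = norm (zmon (u (k m)) \<gamma> / N m) * (1 / real (Suc (k m)))"
          using N0[of m] by (simp add: norm_divide)
        finally show ?thesis .
      qed
      have "(\<lambda>m. norm (zmon (u (k m)) \<gamma> / N m) * (1 / real (Suc (k m)))) \<longlonglongrightarrow> norm (lim \<gamma>) * 0"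
        using LIMSEQ_subseq_LIMSEQ[OF inv0 k] by (intro tendsto_intros ulim S(2)) (simp add: o_def)
      then have "(\<lambda>m. zmon (u (k m)) \<alpha> / N m) \<longlonglongrightarrow> 0"
        unfolding mult_zero_right by (rule Lim_null_comparison[OF always_eventually[OF allI[OF bound]]])
      then have "lim \<alpha> = 0" using ulim[OF \<alpha>] LIMSEQ_unique by blast
      moreover have "zmon (y m) \<alpha> = 0" for m using False \<alpha> S(1) ymon by (auto simp: EJ_def)
      ultimately show ?thesis by simp
    qed
    then show ?thesis unfolding lim_def by (intro exI[of _ N]) (simp add: N_def)
  qed
  show ?thesis
  proof (rule that[of "s \<circ> k" b w])
    show "strict_mono (s \<circ> k)" using s k by (rule strict_mono_o)
    show "w $ i = 0 \<longleftrightarrow> q $ i \<noteq> 0" for i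
      using wr_iff[of i] arg_cong[OF rw, of "\<lambda>v. v $ i"]
      by (simp add: rvec_def) (metis of_nat_eq_0_iff)
    show "\<exists>N :: nat \<Rightarrow> real. (\<forall>m. 0 < N m) \<and>
         (\<forall>\<alpha>\<in>S. (\<lambda>m. zmon (z ((s \<circ> k) m)) \<alpha> / of_real (N m)) \<longlonglongrightarrow> (if \<forall>\<beta>\<in>S. wt w \<alpha> \<le> wt w \<beta> then zmon b \<alpha> else 0))"
      if "S \<subseteq> E" "\<alpha> \<in> S" "zmon (z ((s \<circ> k) m)) \<alpha> \<noteq> 0" for S m \<alpha>
      using main[of S \<alpha> m] that by (simp add: y_def o_def)
  qed (use b0 bq in auto)
qed

section \<open>Polynomials and Newton polyhedra\<close>

definition tsupp :: "'n::finite tzpoly \<Rightarrow> (nat^'n) set" where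
  "tsupp P = {\<alpha>. \<exists>j. P (j, \<alpha>) \<noteq> 0}"

text \<open>The partial derivative of the monomial in coordinate \<open>i\<close>. For
  \<open>\<alpha> $ i = 0\<close> the truncated exponent is harmless, as the leading factor is
  0.\<close>

definition zmon_d :: "'n::finite \<Rightarrow> complex^'n \<Rightarrow> nat^'n \<Rightarrow> complex" where
  "zmon_d i z \<alpha> = of_nat (\<alpha> $ i) * (z $ i) ^ (\<alpha> $ i - 1) * (\<Prod>j\<in>UNIV - {i}. (z $ j) ^ (\<alpha> $ j))"

definition slice_d :: "'n::finite tzpoly \<Rightarrow> complex \<Rightarrow> 'n zpoly" where
  "slice_d P t \<alpha> = (\<Sum>j\<in>{j. P (j, \<alpha>) \<noteq> 0}. P (j, \<alpha>) * (of_nat j * t ^ (j - 1)))"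

definition dt :: "'n::finite tzpoly \<Rightarrow> complex \<times> (complex^'n) \<Rightarrow> complex" where
  "dt P x = (\<Sum>\<alpha>\<in>tsupp P. slice_d P (fst x) \<alpha> * zmon (snd x) \<alpha>)"

definition dz :: "'n::finite tzpoly \<Rightarrow> 'n \<Rightarrow> complex \<times> (complex^'n) \<Rightarrow> complex" where
  "dz P i x = (\<Sum>\<alpha>\<in>tsupp P. slice P (fst x) \<alpha> * zmon_d i (snd x) \<alpha>)"

lemma finite_tsupp: "is_tzpoly P \<Longrightarrow> finite (tsupp P)"
proof -
  assume "is_tzpoly P"
  then have "finite (snd ` {e. P e \<noteq> 0})" by (simp add: is_tzpoly_def)
  moreover have "tsupp P \<subseteq> snd ` {e. P e \<noteq> 0}" by (force simp: tsupp_def)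
  ultimately show ?thesis using finite_subset by blast
qed

lemma finite_tdegrees: "is_tzpoly P \<Longrightarrow> finite {j. P (j, \<alpha>) \<noteq> 0}"
proof -
  assume "is_tzpoly P"
  then have "finite (fst ` {e. P e \<noteq> 0})" by (simp add: is_tzpoly_def)
  moreover have "{j. P (j, \<alpha>) \<noteq> 0} \<subseteq> fst ` {e. P e \<noteq> 0}" by force
  ultimately show ?thesis using finite_subset by blast
qed

text \<open>For a given \<open>t\<close> the inclusion may be strict: a coefficient is a polynomial
  in \<open>t\<close> and can vanish there. Sums are therefore taken over the fixed set
  \<open>tsupp P\<close>.\<close>

lemma slice_support: "slice P t \<alpha> \<noteq> 0 \<Longrightarrow> \<alpha> \<in> tsupp P"
  unfolding slice_def tsupp_def by (metis (mono_tags, lifting) empty_Collect_eq mem_Collect_eq sum.empty)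

lemma finite_slice_support: "is_tzpoly P \<Longrightarrow> finite {\<alpha>. slice P t \<alpha> \<noteq> 0}"
  by (rule finite_subset[OF _ finite_tsupp]) (auto dest: slice_support)

lemma tzeval_eq:
  assumes "is_tzpoly P"
  shows "tzeval P x = (\<Sum>\<alpha>\<in>tsupp P. slice P (fst x) \<alpha> * zmon (snd x) \<alpha>)"
proof -
  define h where "h \<alpha> j = P (j, \<alpha>) * fst x ^ j * zmon (snd x) \<alpha>" for j \<alpha>
  have "tzeval P x = (\<Sum>e\<in>(\<lambda>(\<alpha>, j). (j, \<alpha>)) ` (SIGMA \<alpha>:tsupp P. {j. P (j, \<alpha>) \<noteq> 0}). h (snd e) (fst e))"
    unfolding tzeval_def h_def zmon_def by (intro sum.cong) (auto simp: tsupp_def image_iff)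
  also have "\<dots> = (\<Sum>(\<alpha>, j)\<in>(SIGMA \<alpha>:tsupp P. {j. P (j, \<alpha>) \<noteq> 0}). h \<alpha> j)"
    by (subst sum.reindex) (auto simp: inj_on_def case_prod_beta intro!: sum.cong)
  also have "\<dots> = (\<Sum>\<alpha>\<in>tsupp P. \<Sum>j\<in>{j. P (j, \<alpha>) \<noteq> 0}. h \<alpha> j)"
    using finite_tsupp[OF assms] finite_tdegrees[OF assms] by (subst sum.Sigma) auto
  also have "\<dots> = (\<Sum>\<alpha>\<in>tsupp P. slice P (fst x) \<alpha> * zmon (snd x) \<alpha>)"
    by (simp add: slice_def h_def sum_distrib_right)
  finally show ?thesis .
qed

lemma tendsto_slice [tendsto_intros]:
  "(f \<longlongrightarrow> t) A \<Longrightarrow> ((\<lambda>x. slice P (f x) \<alpha>) \<longlongrightarrow> slice P t \<alpha>) A"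
  unfolding slice_def by (intro tendsto_intros)

lemma tendsto_slice_d [tendsto_intros]:
  "(f \<longlongrightarrow> t) A \<Longrightarrow> ((\<lambda>x. slice_d P (f x) \<alpha>) \<longlongrightarrow> slice_d P t \<alpha>) A"
  unfolding slice_d_def by (intro tendsto_intros)

lemma tendsto_dt: "(f \<longlongrightarrow> x) A \<Longrightarrow> ((\<lambda>y. dt P (f y)) \<longlongrightarrow> dt P x) A"
  unfolding dt_def by (intro tendsto_intros)

lemma tendsto_dz: "(f \<longlongrightarrow> x) A \<Longrightarrow> ((\<lambda>y. dz P i (f y)) \<longlongrightarrow> dz P i x) A"
  unfolding dz_def zmon_d_def by (intro tendsto_intros)

lemma zmon_d_mult: "z $ i * zmon_d i z \<alpha> = of_nat (\<alpha> $ i) * zmon z \<alpha>"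
proof -
  have "zmon z \<alpha> = z $ i ^ (\<alpha> $ i) * (\<Prod>j\<in>UNIV - {i}. (z $ j) ^ (\<alpha> $ j))"
    unfolding zmon_def by (rule prod.remove) auto
  then show ?thesis by (cases "\<alpha> $ i") (auto simp: zmon_d_def)
qed

text \<open>Multiplication by the coordinate leaves the same monomials, with the exponents as extra
  factors; so a scale that controls the values also controls the logarithmic derivatives.\<close>

lemma dz_mult: "snd x $ i * dz P i x = (\<Sum>\<alpha>\<in>tsupp P. slice P (fst x) \<alpha> * (of_nat (\<alpha> $ i) * zmon (snd x) \<alpha>))"
  unfolding dz_def sum_distrib_left by (intro sum.cong refl) (simp add: mult.left_commute flip: zmon_d_mult)

lemma zmon_has_derivative: "((\<lambda>z. zmon z \<alpha>) has_derivative (\<lambda>v. \<Sum>i\<in>UNIV. zmon_d i z \<alpha> * v $ i)) (at z)"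
  for z :: "complex^'n"
proof -
  have "((\<lambda>z. z $ i) has_derivative (\<lambda>v. v $ i)) (at z)" for i
    by (rule bounded_linear.has_derivative[OF bounded_linear_vec_nth has_derivative_ident])
  then have "((\<lambda>z. z $ i ^ (\<alpha> $ i)) has_derivative (\<lambda>v. of_nat (\<alpha> $ i) * v $ i * z $ i ^ (\<alpha> $ i - 1))) (at z)" for i
    by (rule has_derivative_power)
  then have "((\<lambda>z. \<Prod>i\<in>UNIV. z $ i ^ (\<alpha> $ i)) has_derivative
     (\<lambda>v. \<Sum>i\<in>UNIV. (of_nat (\<alpha> $ i) * v $ i * z $ i ^ (\<alpha> $ i - 1)) * (\<Prod>j\<in>UNIV - {i}. z $ j ^ (\<alpha> $ j)))) (at z)"
    by (intro has_derivative_prod)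
  then show ?thesis
    by (simp add: zmon_d_def zmon_def mult_ac)
qed

lemma slice_has_field_derivative: "((\<lambda>t. slice P t \<alpha>) has_field_derivative slice_d P t \<alpha>) (at t)"
  unfolding slice_def slice_d_def
  by (intro DERIV_sum) (auto intro!: derivative_eq_intros)

lemma tzeval_has_derivative:
  fixes P :: "'n::finite tzpoly"
  assumes "is_tzpoly P"
  shows "(tzeval P has_derivative (\<lambda>v. dt P x * fst v + (\<Sum>i\<in>UNIV. dz P i x * snd v $ i))) (at x)"
proof -
  have 1: "((\<lambda>x. slice P (fst x) \<alpha>) has_derivative (\<lambda>v. slice_d P (fst x) \<alpha> * fst v)) (at x)" for \<alpha> :: "nat^'n"
    by (rule has_derivative_compose[OF has_derivative_fst[OF has_derivative_ident]
        slice_has_field_derivative[unfolded has_field_derivative_def]])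
  have 2: "((\<lambda>x. zmon (snd x) \<alpha>) has_derivative (\<lambda>v. \<Sum>i\<in>UNIV. zmon_d i (snd x) \<alpha> * snd v $ i)) (at x)" for \<alpha> :: "nat^'n"
    by (rule has_derivative_compose[OF has_derivative_snd[OF has_derivative_ident] zmon_has_derivative])
  have "((\<lambda>x. \<Sum>\<alpha>\<in>tsupp P. slice P (fst x) \<alpha> * zmon (snd x) \<alpha>) has_derivative
     (\<lambda>v. \<Sum>\<alpha>\<in>tsupp P. slice P (fst x) \<alpha> * (\<Sum>i\<in>UNIV. zmon_d i (snd x) \<alpha> * snd v $ i)
          + slice_d P (fst x) \<alpha> * fst v * zmon (snd x) \<alpha>)) (at x)"
    by (intro has_derivative_sum has_derivative_mult 1 2)
  moreover have "(\<lambda>v. \<Sum>\<alpha>\<in>tsupp P. slice P (fst x) \<alpha> * (\<Sum>i\<in>UNIV. zmon_d i (snd x) \<alpha> * snd v $ i)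
          + slice_d P (fst x) \<alpha> * fst v * zmon (snd x) \<alpha>)
     = (\<lambda>v. dt P x * fst v + (\<Sum>i\<in>UNIV. dz P i x * snd v $ i))"
    unfolding dt_def dz_def sum.distrib sum_distrib_left sum_distrib_right
    by (subst sum.swap) (simp add: mult_ac add.commute)
  ultimately show ?thesis unfolding tzeval_eq[OF assms, abs_def] by simp
qed

lemma partial_zeval:
  assumes "finite {\<alpha>. g \<alpha> \<noteq> 0}"
  shows "z $ i * partial i (zeval g) z = (\<Sum>\<alpha>\<in>{\<alpha>. g \<alpha> \<noteq> 0}. g \<alpha> * (of_nat (\<alpha> $ i) * zmon z \<alpha>))"
proof -
  define c where "c \<alpha> = (\<Prod>j\<in>UNIV - {i}. (z $ j) ^ (\<alpha> $ j))" for \<alpha>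
  have "zeval g (\<chi> j. if j = i then s else z $ j) = (\<Sum>\<alpha>\<in>{\<alpha>. g \<alpha> \<noteq> 0}. g \<alpha> * (s ^ (\<alpha> $ i) * c \<alpha>))" for s
    unfolding zeval_def
  proof (intro sum.cong refl arg_cong2[of _ _ _ _ "(*)"])
    fix \<alpha> :: "nat^'a"
    have "(\<Prod>j\<in>UNIV. (\<chi> j. if j = i then s else z $ j) $ j ^ \<alpha> $ j)
        = s ^ (\<alpha> $ i) * (\<Prod>j\<in>UNIV - {i}. (\<chi> j. if j = i then s else z $ j) $ j ^ \<alpha> $ j)"
      by (subst prod.remove[of _ i]) auto
    then show "(\<Prod>j\<in>UNIV. (\<chi> j. if j = i then s else z $ j) $ j ^ \<alpha> $ j) = s ^ (\<alpha> $ i) * c \<alpha>"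
      by (simp add: c_def)
  qed
  moreover have "((\<lambda>s. \<Sum>\<alpha>\<in>{\<alpha>. g \<alpha> \<noteq> 0}. g \<alpha> * (s ^ (\<alpha> $ i) * c \<alpha>)) has_field_derivative
      (\<Sum>\<alpha>\<in>{\<alpha>. g \<alpha> \<noteq> 0}. g \<alpha> * zmon_d i z \<alpha>)) (at (z $ i))"
    by (intro DERIV_sum) (auto intro!: derivative_eq_intros simp: zmon_d_def c_def)
  ultimately have "partial i (zeval g) z = (\<Sum>\<alpha>\<in>{\<alpha>. g \<alpha> \<noteq> 0}. g \<alpha> * zmon_d i z \<alpha>)"
    unfolding partial_def by (simp add: DERIV_imp_deriv)
  then show ?thesis
    by (simp add: sum_distrib_left mult.left_commute flip: zmon_d_mult)
qed

text \<open>The coefficient of \<open>\<alpha>\<close> is a nonzero polynomial in \<open>t\<close>,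
  with finitely many roots, and a disc is infinite.\<close>

lemma slice_nonzero_near_0:
  assumes "is_tzpoly P" "\<alpha> \<in> tsupp P" "\<epsilon> > 0"
  obtains t where "norm t < \<epsilon>" "slice P t \<alpha> \<noteq> 0"
proof -
  obtain j0 where j0: "P (j0, \<alpha>) \<noteq> 0" using assms(2) by (auto simp: tsupp_def)
  define n where "n = Max {j. P (j, \<alpha>) \<noteq> 0}"
  have le: "j \<le> n" if "P (j, \<alpha>) \<noteq> 0" for j
    unfolding n_def using that finite_tdegrees[OF assms(1)] by (intro Max_ge) auto
  have "slice P t \<alpha> = (\<Sum>j\<le>n. P (j, \<alpha>) * t ^ j)" for t
    unfolding slice_def using le by (intro sum.mono_neutral_left) auto
  then have "finite {t. slice P t \<alpha> = 0}"
    using polyfun_finite_roots[of "\<lambda>j. P (j, \<alpha>)" n] j0 le[OF j0] by auto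
  moreover have "infinite (ball 0 \<epsilon> :: complex set)"
    using uncountable_ball[OF assms(3)] countable_finite by blast
  ultimately obtain t where "t \<in> ball 0 \<epsilon>" "slice P t \<alpha> \<noteq> 0"
    using finite_subset[of "ball 0 \<epsilon>" "{t. slice P t \<alpha> = 0}"] by blast
  then show ?thesis using that by (simp add: dist_norm)
qed

section \<open>Newton polyhedra, least weights and face functions\<close>

lemma rvec_in_newton_polyhedron: "g \<alpha> \<noteq> 0 \<Longrightarrow> rvec \<alpha> \<in> newton_polyhedron g"
  unfolding newton_polyhedron_def by (intro hull_inc) (auto simp: rvec_def)

text \<open>A half-space is convex and, the weights being nonnegative, contains the orthant above
  each exponent in it; hence it contains the hull.\<close>

lemma newton_polyhedron_weight_ge:
  assumes "\<And>\<alpha>. g \<alpha> \<noteq> 0 \<Longrightarrow> c \<le> rvec w \<bullet> rvec \<alpha>" "x \<in> newton_polyhedron g"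
  shows "c \<le> rvec w \<bullet> x"
proof -
  have "newton_polyhedron g \<subseteq> {x. rvec w \<bullet> x \<ge> c}"
    unfolding newton_polyhedron_def
  proof (rule hull_minimal)
    show "(\<Union>\<alpha>\<in>{\<alpha>. g \<alpha> \<noteq> 0}. {x. \<forall>i. real (\<alpha> $ i) \<le> x $ i}) \<subseteq> {x. rvec w \<bullet> x \<ge> c}"
    proof clarify
      fix \<alpha> x assume *: "g \<alpha> \<noteq> 0" "\<forall>i. real (\<alpha> $ i) \<le> (x :: real^'a) $ i"
      have "rvec w \<bullet> rvec \<alpha> \<le> rvec w \<bullet> x"
        unfolding inner_vec_def using *(2) by (intro sum_mono) (auto simp: rvec_def intro: mult_left_mono)
      with assms(1)[OF *(1)] show "c \<le> rvec w \<bullet> x" by simp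
    qed
    show "convex {x. rvec w \<bullet> x \<ge> c}" by (rule convex_halfspace_ge)
  qed
  then show ?thesis using assms(2) by auto
qed

lemma wdeg_eq:
  assumes "g \<alpha> \<noteq> 0" "\<And>\<beta>. g \<beta> \<noteq> 0 \<Longrightarrow> wt w \<alpha> \<le> wt w \<beta>"
  shows "wdeg w g = real (wt w \<alpha>)"
  unfolding wdeg_def
proof (rule cInf_eq_minimum)
  show "real (wt w \<alpha>) \<in> {\<Sum>i\<in>UNIV. real (w $ i) * x $ i |x. x \<in> newton_polyhedron g}"
    using rvec_in_newton_polyhedron[of g, OF assms(1)]
    by (auto simp: wt_def rvec_def intro!: exI[of _ "rvec \<alpha>"])
next
  fix y assume "y \<in> {\<Sum>i\<in>UNIV. real (w $ i) * x $ i |x. x \<in> newton_polyhedron g}"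
  then obtain x where x: "x \<in> newton_polyhedron g" "y = rvec w \<bullet> x"
    by (auto simp: rvec_def inner_vec_def)
  show "real (wt w \<alpha>) \<le> y" unfolding x(2)
    by (rule newton_polyhedron_weight_ge[OF _ x(1)]) (use assms(2) in \<open>simp flip: real_wt\<close>)
qed

text \<open>The minimum of the weight over the polyhedron is attained at an exponent of
  \<open>g\<close>, so an exponent of \<open>g\<close> lies on the face exactly if its weight is
  least. This describes the face function by weights alone.\<close>

lemma face_fun_eq:
  assumes "finite {\<alpha>. g \<alpha> \<noteq> 0}"
  shows "face_fun w g \<alpha> = (if \<forall>\<beta>. g \<beta> \<noteq> 0 \<longrightarrow> wt w \<alpha> \<le> wt w \<beta> then g \<alpha> else 0)"
proof (cases "g \<alpha> = 0")
  case True
  then show ?thesis by (simp add: face_fun_def)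
next
  case False
  obtain a where a: "g a \<noteq> 0" "\<And>\<beta>. g \<beta> \<noteq> 0 \<Longrightarrow> wt w a \<le> wt w \<beta>"
    using ex_has_least_nat[of "\<lambda>x. g x \<noteq> 0" \<alpha> "wt w"] False by auto
  have "rvec \<alpha> \<in> wface w g \<longleftrightarrow> wt w \<alpha> = wt w a"
    using rvec_in_newton_polyhedron[of g, OF False] wdeg_eq[of g, OF a] real_wt[of w \<alpha>]
    by (simp add: wface_def rvec_def inner_vec_def) (metis of_nat_eq_iff)
  then have "rvec \<alpha> \<in> wface w g \<longleftrightarrow> (\<forall>\<beta>. g \<beta> \<noteq> 0 \<longrightarrow> wt w \<alpha> \<le> wt w \<beta>)"
    using a False by (metis le_antisym)
  then show ?thesis by (simp add: face_fun_def rvec_def)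
qed

text \<open>For a finite support the first summand is compact and the second a closed cone, which
  yields closedness of the polyhedron.\<close>

lemma newton_polyhedron_sum:
  fixes g :: "'n::finite zpoly"
  shows "newton_polyhedron g = (\<Union>x\<in>convex hull (rvec ` {\<alpha>. g \<alpha> \<noteq> 0}). \<Union>y\<in>{y. \<forall>i. 0 \<le> y $ i}. {x + y})"
    (is "_ = ?R")
proof
  have "convex {y :: real^'n. \<forall>i. 0 \<le> y $ i}"
    by (auto simp: convex_def)
  then have "convex ?R" by (intro convex_sums convex_convex_hull)
  moreover have "(\<Union>\<alpha>\<in>{\<alpha>. g \<alpha> \<noteq> 0}. {x. \<forall>i. real (\<alpha> $ i) \<le> x $ i}) \<subseteq> ?R"
  proof clarify
    fix \<alpha> and x :: "real^'n" assume *: "g \<alpha> \<noteq> 0" "\<forall>i. real (\<alpha> $ i) \<le> x $ i"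
    have "rvec \<alpha> \<in> convex hull (rvec ` {\<alpha>. g \<alpha> \<noteq> 0})" using *(1) by (intro hull_inc) auto
    moreover have "x - rvec \<alpha> \<in> {y. \<forall>i. 0 \<le> y $ i}" using *(2) by (auto simp: rvec_def)
    moreover have "x = rvec \<alpha> + (x - rvec \<alpha>)" by simp
    ultimately show "x \<in> ?R" by blast
  qed
  ultimately show "newton_polyhedron g \<subseteq> ?R" unfolding newton_polyhedron_def by (intro hull_minimal)
  show "?R \<subseteq> newton_polyhedron g"
  proof clarsimp
    fix x y :: "real^'n" assume x: "x \<in> convex hull (rvec ` {\<alpha>. g \<alpha> \<noteq> 0})" and y: "\<forall>i. 0 \<le> y $ i"
    have "convex ((\<lambda>x. - y + x) ` newton_polyhedron g)"
      unfolding newton_polyhedron_def by (intro convex_translation convex_convex_hull)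
    moreover have "rvec ` {\<alpha>. g \<alpha> \<noteq> 0} \<subseteq> (\<lambda>x. - y + x) ` newton_polyhedron g"
    proof clarify
      fix \<alpha> assume "g \<alpha> \<noteq> 0"
      then have "y + rvec \<alpha> \<in> newton_polyhedron g" unfolding newton_polyhedron_def
        using y by (intro hull_inc) (auto simp: rvec_def intro!: bexI[of _ \<alpha>])
      then show "rvec \<alpha> \<in> (\<lambda>x. - y + x) ` newton_polyhedron g"
        by (intro image_eqI[of _ _ "y + rvec \<alpha>"]) auto
    qed
    ultimately have "x \<in> (\<lambda>x. - y + x) ` newton_polyhedron g"
      using x hull_minimal by (metis subsetD)
    then show "x + y \<in> newton_polyhedron g" by (auto simp: algebra_simps)
  qed
qed

lemma closed_newton_polyhedron:
  assumes "finite {\<alpha>. g \<alpha> \<noteq> 0}"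
  shows "closed (newton_polyhedron g)"
proof -
  have "closed {y :: real^'a. \<forall>i. 0 \<le> y $ i}"
    by (intro closed_Collect_all closed_Collect_le continuous_intros)
  then show ?thesis unfolding newton_polyhedron_sum
    using assms by (intro compact_closed_sums finite_imp_compact_convex_hull) auto
qed

text \<open>With all weights positive, the face of least weight is bounded, because its points have
  nonnegative coordinates with a fixed weighted sum. It is also closed, hence a compact face, and it
  contains the exponent \<open>a\<close>.\<close>

lemma rvec_in_newton_boundary:
  assumes fin: "finite {\<alpha>. g \<alpha> \<noteq> 0}" and w: "\<And>i. 0 < w $ i"
    and a: "g a \<noteq> 0" "\<And>\<beta>. g \<beta> \<noteq> 0 \<Longrightarrow> wt w a \<le> wt w \<beta>"
  shows "rvec a \<in> newton_boundary g"
proof -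
  define F where "F = newton_polyhedron g \<inter> {x. rvec w \<bullet> x = real (wt w a)}"
  have ge: "real (wt w a) \<le> rvec w \<bullet> x" if "x \<in> newton_polyhedron g" for x
    by (rule newton_polyhedron_weight_ge[OF _ that]) (use a(2) in \<open>simp flip: real_wt\<close>)
  have "F face_of newton_polyhedron g" unfolding F_def
    using ge by (intro face_of_Int_supporting_hyperplane_ge) (auto simp: newton_polyhedron_def)
  moreover have "compact F"
  proof (rule compact_eq_bounded_closed[THEN iffD2], intro conjI)
    show "closed F" unfolding F_def
      by (intro closed_Int closed_newton_polyhedron fin closed_hyperplane)
    have "norm x \<le> (\<Sum>i\<in>(UNIV :: 'a set). real (wt w a))" if "x \<in> F" for x
    proof -
      have pos: "0 \<le> x $ i" for i
      proof -
        have "rvec (axis i 1) = axis i 1" by (simp add: rvec_def axis_def vec_eq_iff)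
        then show ?thesis
          using newton_polyhedron_weight_ge[of g 0 "axis i 1" x] that
          by (simp add: F_def inner_axis' rvec_def)
      qed
      have "\<bar>x $ i\<bar> \<le> real (wt w a)" for i
      proof -
        have "\<bar>x $ i\<bar> = 1 * x $ i" using pos by simp
        also have "\<dots> \<le> real (w $ i) * x $ i" using w[of i] pos[of i] by (intro mult_right_mono) auto
        also have "\<dots> \<le> (\<Sum>i\<in>UNIV. real (w $ i) * x $ i)"
          using pos by (intro member_le_sum) auto
        also have "\<dots> = real (wt w a)" using that by (simp add: F_def rvec_def inner_vec_def)
        finally show ?thesis .
      qed
      then have "(\<Sum>i\<in>UNIV. \<bar>x $ i\<bar>) \<le> (\<Sum>i\<in>(UNIV :: 'a set). real (wt w a))" by (intro sum_mono)
      then show ?thesis using norm_le_l1_cart[of x] by linarith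
    qed
    then show "bounded F" unfolding bounded_iff by blast
  qed
  moreover have "rvec a \<in> F"
    using rvec_in_newton_polyhedron[of g, OF a(1)] by (simp add: F_def real_wt)
  ultimately show ?thesis by (auto simp: newton_boundary_def)
qed

text \<open>A least-weight exponent \<open>a\<close> of \<open>g\<close> lies on the common Newton
  boundary, hence in the polyhedron of \<open>h\<close>. If all exponents of \<open>h\<close> were
  heavier, integrality would put that whole polyhedron at weight \<open>wt w a + 1\<close> or
  more.\<close>

lemma newton_boundary_min_weight_pos:
  assumes "finite {\<alpha>. g \<alpha> \<noteq> 0}" "\<And>i. 0 < w $ i" "newton_boundary g = newton_boundary h" "g \<alpha> \<noteq> 0"
  obtains \<beta> where "h \<beta> \<noteq> 0" "wt w \<beta> \<le> wt w \<alpha>"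
proof -
  obtain a where a: "g a \<noteq> 0" "\<And>\<beta>. g \<beta> \<noteq> 0 \<Longrightarrow> wt w a \<le> wt w \<beta>"
    using ex_has_least_nat[of "\<lambda>x. g x \<noteq> 0" \<alpha> "wt w"] assms(4) by auto
  have "rvec a \<in> newton_boundary h"
    using rvec_in_newton_boundary[of g w a] assms a by simp
  then have "rvec a \<in> newton_polyhedron h"
    unfolding newton_boundary_def by (blast dest: face_of_imp_subset)
  then have "\<not> (\<forall>\<beta>. h \<beta> \<noteq> 0 \<longrightarrow> real (wt w a) + 1 \<le> rvec w \<bullet> rvec \<beta>)"
    using newton_polyhedron_weight_ge[of h "real (wt w a) + 1" w "rvec a"] by (auto simp flip: real_wt)
  then obtain \<beta> where "h \<beta> \<noteq> 0" "wt w \<beta> \<le> wt w a" by (auto simp flip: real_wt)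
  then show ?thesis using that a(2)[OF assms(4)] by force
qed

text \<open>A weight \<open>w\<close> with zero entries is perturbed to the positive weight \<open>K w + 1\<close>, with \<open>K\<close> so
  large that it orders the exponents as \<open>w\<close> does.\<close>
lemma slice_min_weight:
  fixes P :: "'n::finite tzpoly"
  assumes P: "is_tzpoly P" and "\<epsilon> > 0"
    and nb: "\<And>t. norm t < \<epsilon> \<Longrightarrow> newton_boundary (slice P t) = newton_boundary (slice P 0)"
    and t: "norm t < \<epsilon>" and \<alpha>: "\<alpha> \<in> tsupp P"
  obtains \<beta> where "slice P t \<beta> \<noteq> 0" "wt w \<beta> \<le> wt w \<alpha>"
proof -
  have fin: "finite {\<alpha>. slice P t \<alpha> \<noteq> 0}" for t
    by (rule finite_slice_support[OF P])
  define sz where "sz \<beta> = (\<Sum>i\<in>UNIV. \<beta> $ i)" for \<beta> :: "nat^'n"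
  define K where "K = sz \<alpha> + 1"
  define w' :: "nat^'n" where "w' = (\<chi> i. K * w $ i + 1)"
  have w': "wt w' \<beta> = K * wt w \<beta> + sz \<beta>" for \<beta>
    by (simp add: wt_def w'_def sz_def sum.distrib sum_distrib_left algebra_simps)
  \<comment> \<open>The coefficient of \<open>\<alpha>\<close> may vanish at \<open>t\<close>, so
    the comparison starts from another parameter \<open>t'\<close> in the disc where it does not;
    constancy of the Newton boundary leads back to \<open>t\<close>.\<close>
  obtain t' where t': "norm t' < \<epsilon>" "slice P t' \<alpha> \<noteq> 0"
    using slice_nonzero_near_0[OF P \<alpha> \<open>\<epsilon> > 0\<close>] by metis
  have "newton_boundary (slice P t') = newton_boundary (slice P t)" using nb t t'(1) by simp
  from newton_boundary_min_weight_pos[of "slice P t'" w', OF fin _ this t'(2)]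
  obtain \<beta> where \<beta>: "slice P t \<beta> \<noteq> 0" "wt w' \<beta> \<le> wt w' \<alpha>" by (auto simp: w'_def)
  have "wt w \<beta> \<le> wt w \<alpha>"
  proof (rule ccontr)
    assume "\<not> wt w \<beta> \<le> wt w \<alpha>"
    then have "K * (wt w \<alpha> + 1) \<le> K * wt w \<beta>" by (intro mult_le_mono) auto
    then show False using \<beta>(2) by (simp add: w' K_def)
  qed
  then show ?thesis using that \<beta>(1) by blast
qed

text \<open>The least weight over the exponents of the slice equals that over all of
  \<open>tsupp P\<close>, so the selection of the face does not depend on \<open>t\<close>. The
  factor \<open>h\<close> is arbitrary in order to cover both the face function and its logarithmic
  derivatives.\<close>

lemma face_sum:
  assumes P: "is_tzpoly P" and "\<epsilon> > 0"
    and nb: "\<And>t. norm t < \<epsilon> \<Longrightarrow> newton_boundary (slice P t) = newton_boundary (slice P 0)"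
    and t: "norm t < \<epsilon>"
  shows "(\<Sum>\<alpha>\<in>{\<alpha>. face_fun w (slice P t) \<alpha> \<noteq> 0}. face_fun w (slice P t) \<alpha> * h \<alpha>)
    = (\<Sum>\<alpha>\<in>tsupp P. slice P t \<alpha> * (if \<forall>\<beta>\<in>tsupp P. wt w \<alpha> \<le> wt w \<beta> then h \<alpha> else 0))"
proof -
  have fin: "finite {\<alpha>. slice P t \<alpha> \<noteq> 0}"
    by (rule finite_slice_support[OF P])
  have face: "face_fun w (slice P t) \<alpha> = (if \<forall>\<beta>\<in>tsupp P. wt w \<alpha> \<le> wt w \<beta> then slice P t \<alpha> else 0)" for \<alpha>
  proof -
    have "(\<forall>\<beta>. slice P t \<beta> \<noteq> 0 \<longrightarrow> wt w \<alpha> \<le> wt w \<beta>) \<longleftrightarrow> (\<forall>\<beta>\<in>tsupp P. wt w \<alpha> \<le> wt w \<beta>)"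
    proof (intro iffI ballI allI impI)
      fix \<beta> assume *: "\<forall>\<beta>. slice P t \<beta> \<noteq> 0 \<longrightarrow> wt w \<alpha> \<le> wt w \<beta>" and \<beta>: "\<beta> \<in> tsupp P"
      obtain \<beta>' where "slice P t \<beta>' \<noteq> 0" "wt w \<beta>' \<le> wt w \<beta>"
        using slice_min_weight[OF assms \<beta>, of w] by metis
      with * show "wt w \<alpha> \<le> wt w \<beta>" by (meson order_trans)
    qed (use slice_support in blast)
    then show ?thesis by (simp add: face_fun_eq[OF fin])
  qed
  have "(\<Sum>\<alpha>\<in>{\<alpha>. face_fun w (slice P t) \<alpha> \<noteq> 0}. face_fun w (slice P t) \<alpha> * h \<alpha>)
    = (\<Sum>\<alpha>\<in>tsupp P. face_fun w (slice P t) \<alpha> * h \<alpha>)"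
    using finite_tsupp[OF P] slice_support by (intro sum.mono_neutral_left) (auto simp: face split: if_splits)
  also have "\<dots> = (\<Sum>\<alpha>\<in>tsupp P. slice P t \<alpha> * (if \<forall>\<beta>\<in>tsupp P. wt w \<alpha> \<le> wt w \<beta> then h \<alpha> else 0))"
    by (intro sum.cong refl) (simp add: face)
  finally show ?thesis .
qed

section \<open>Tangent spaces and limits of hyperplanes\<close>

lemma bounded_family_subseq:
  fixes y :: "nat \<Rightarrow> 'k \<Rightarrow> complex"
  assumes "finite K" "\<And>k. k \<in> K \<Longrightarrow> \<exists>B. \<forall>m. norm (y m k) \<le> B"
  obtains r l where "strict_mono (r :: nat \<Rightarrow> nat)" "\<And>k. k \<in> K \<Longrightarrow> (\<lambda>m. y (r m) k) \<longlonglongrightarrow> l k"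
proof -
  obtain r where r: "strict_mono (r :: nat \<Rightarrow> nat)" and conv: "\<forall>k\<in>K. convergent (\<lambda>m. y (r m) k)"
  proof (rule finite_common_subseq[OF assms(1), of "\<lambda>k s. convergent (\<lambda>m. y (s m) k)"])
    fix k and s :: "nat \<Rightarrow> nat" assume "k \<in> K"
    then have "bounded (range (\<lambda>m. y (s m) k))" using assms(2) by (fastforce simp: bounded_iff)
    then obtain l r where "strict_mono r" "((\<lambda>m. y (s m) k) \<circ> r) \<longlonglongrightarrow> l"
      using bounded_imp_convergent_subsequence by blast
    then show "\<exists>r. strict_mono r \<and> convergent (\<lambda>m. y ((s \<circ> r) m) k)"
      by (auto simp: o_def convergent_def)
  next
    fix k and s r :: "nat \<Rightarrow> nat" assume "convergent (\<lambda>m. y (s m) k)" "strict_mono r"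
    then show "convergent (\<lambda>m. y ((s \<circ> r) m) k)"
      using convergent_subseq_convergent by (fastforce simp: o_def)
  qed
  then have "(\<lambda>m. y (r m) k) \<longlonglongrightarrow> lim (\<lambda>m. y (r m) k)" if "k \<in> K" for k
    using that convergent_LIMSEQ_iff by blast
  with r show ?thesis by (rule that)
qed

text \<open>On \<open>S\<close> the increment of \<open>h\<close> is 0, so differentiability bounds
  \<open>h'\<close> on secants by an arbitrarily small multiple of their length. Rescaling by
  \<open>c m\<close> and passing to the limit gives the claim.\<close>

lemma tangent_space_derivative:
  assumes "(h has_derivative h') (at p)" "\<And>y. y \<in> S \<Longrightarrow> h y = h p" "v \<in> tangent_space S p"
  shows "h' v = 0"
proof -
  obtain x c where x: "\<And>m. x m \<in> S" "x \<longlonglongrightarrow> p" and c: "\<And>m. c m > 0" and lim: "(\<lambda>m. c m *\<^sub>R (x m - p)) \<longlonglongrightarrow> v"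
    using assms(3) by (auto simp: tangent_space_def)
  have lin: "bounded_linear h'" using assms(1) by (rule has_derivative_bounded_linear)
  have le: "norm (h' v) \<le> e * norm v" if "e > 0" for e
  proof -
    obtain d where d: "d > 0" "\<And>y. norm (y - p) < d \<Longrightarrow> norm (h y - h p - h' (y - p)) \<le> e * norm (y - p)"
      using assms(1) \<open>e > 0\<close> by (auto simp: has_derivative_at_alt)
    have "eventually (\<lambda>m. norm (x m - p) < d) sequentially"
      using tendstoD[OF x(2) d(1)] by (simp add: dist_norm)
    then have "eventually (\<lambda>m. norm (h' (c m *\<^sub>R (x m - p))) \<le> e * norm (c m *\<^sub>R (x m - p))) sequentially"
    proof eventually_elim
      case (elim m)
      have "norm (h' (x m - p)) \<le> e * norm (x m - p)" using d(2)[OF elim] assms(2)[OF x(1)[of m]] by simp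
      then show ?case using c[of m]
        by (simp add: linear_cmul[OF bounded_linear.linear[OF lin]] mult.left_commute)
    qed
    moreover have "(\<lambda>m. norm (h' (c m *\<^sub>R (x m - p)))) \<longlonglongrightarrow> norm (h' v)"
      by (intro tendsto_norm bounded_linear.tendsto[OF lin] lim)
    moreover have "(\<lambda>m. e * norm (c m *\<^sub>R (x m - p))) \<longlonglongrightarrow> e * norm v"
      by (intro tendsto_mult_left tendsto_norm lim)
    ultimately show ?thesis using tendsto_le[OF sequentially_bot] by blast
  qed
  show ?thesis
  proof (rule ccontr)
    assume *: "h' v \<noteq> 0"
    define b where "b = norm v + 1"
    have b: "b > 0" unfolding b_def by (rule add_nonneg_pos) auto
    have vb: "norm v < b" by (simp add: b_def)
    have "norm (h' v) \<le> norm (h' v) / b * norm v" using * b by (intro le) simp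
    also have "\<dots> = norm (h' v) * (norm v / b)" by simp
    also have "\<dots> < norm (h' v) * 1" using * b vb by (intro mult_strict_left_mono) auto
    finally show False by simp
  qed
qed

text \<open>The complex bilinear pairing of a covector with a vector, without conjugation, as needed
  for complex differentials.\<close>

definition cpair :: "complex \<times> (complex^'n::finite) \<Rightarrow> complex \<times> (complex^'n) \<Rightarrow> complex" where
  "cpair a v = fst a * fst v + (\<Sum>i\<in>UNIV. snd a $ i * snd v $ i)"

lemma tendsto_cpair: "(f \<longlongrightarrow> a) A \<Longrightarrow> (g \<longlongrightarrow> v) A \<Longrightarrow> ((\<lambda>m. cpair (f m) (g m)) \<longlongrightarrow> cpair a v) A"
  unfolding cpair_def by (intro tendsto_intros)

lemma cpair_scaleR: "cpair (c *\<^sub>R a) v = c *\<^sub>R cpair a v" "cpair a (c *\<^sub>R v) = c *\<^sub>R cpair a v"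
  by (auto simp: cpair_def scaleR_right_distrib scaleR_sum_right)

lemma subspace_cpair_kernel: "subspace {v. cpair a v = 0}"
proof (intro subspaceI)
  fix u v assume "u \<in> {v. cpair a v = 0}" "v \<in> {v. cpair a v = 0}"
  moreover have "cpair a (u + v) = cpair a u + cpair a v"
    by (simp add: cpair_def algebra_simps sum.distrib)
  ultimately show "u + v \<in> {v. cpair a v = 0}" by simp
qed (auto simp: cpair_scaleR, auto simp: cpair_def)

text \<open>As a real subspace, the kernel is the orthogonal complement of \<open>A\<close> and
  \<open>B\<close>, which represent the real and imaginary parts of the pairing. These are nonzero
  and orthogonal, so two of the \<open>2 * CARD('n) + 2\<close> real dimensions are lost.\<close>

lemma dim_cpair_kernel:
  fixes a :: "complex \<times> (complex^'n::finite)"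
  assumes "a \<noteq> 0"
  shows "dim {v. cpair a v = 0} = 2 * CARD('n)"
proof -
  define A :: "complex \<times> (complex^'n)" where "A = (cnj (fst a), \<chi> i. cnj (snd a $ i))"
  define B :: "complex \<times> (complex^'n)" where "B = (\<i> * cnj (fst a), \<chi> i. \<i> * cnj (snd a $ i))"
  have A: "A \<bullet> v = Re (cpair a v)" for v
    by (simp add: A_def cpair_def inner_prod_def inner_vec_def inner_complex_def)
  have B: "B \<bullet> v = Im (cpair a v)" for v
    by (simp add: B_def cpair_def inner_prod_def inner_vec_def inner_complex_def algebra_simps)
  have A0: "A \<noteq> 0" using assms by (auto simp: A_def prod_eq_iff vec_eq_iff)
  have B0: "B \<noteq> 0" using assms by (auto simp: B_def prod_eq_iff vec_eq_iff)
  have AB: "A \<bullet> B = 0"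
    by (simp add: A_def B_def inner_prod_def inner_vec_def inner_complex_def algebra_simps)
  have "A \<noteq> B" using AB A0 by auto
  moreover have "independent {A, B}"
    using AB A0 B0 by (intro pairwise_orthogonal_independent) (auto simp: pairwise_def orthogonal_def inner_commute)
  ultimately have "dim {A, B} = 2" by (simp add: dim_eq_card_independent)
  moreover have "{v. cpair a v = 0} = {v \<in> UNIV. \<forall>x\<in>span {A, B}. orthogonal x v}"
  proof -
    have "{v. cpair a v = 0} = {v. \<forall>x\<in>{A, B}. orthogonal x v}"
      by (auto simp: orthogonal_def A B complex_eq_iff)
    also have "\<dots> = {v. \<forall>x\<in>span {A, B}. orthogonal x v}"
    proof (intro Collect_cong iffI ballI)
      fix v x assume "\<forall>x\<in>{A, B}. orthogonal x v" "x \<in> span {A, B}"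
      then have "orthogonal v x" by (intro orthogonal_to_span[of x "{A, B}"]) (auto simp: orthogonal_commute)
      then show "orthogonal x v" by (simp add: orthogonal_commute)
    next
      fix v x assume "\<forall>x\<in>span {A, B}. orthogonal x v" "x \<in> {A, B}"
      then show "orthogonal x v" using span_base[of x "{A, B}"] by blast
    qed
    finally show ?thesis by simp
  qed
  ultimately show ?thesis
    using dim_subspace_orthogonal_to_vectors[of "span {A, B}" "UNIV :: (complex \<times> (complex^'n)) set"]
    by (simp add: dim_UNIV)
qed

section \<open>Vectors of a limit subspace as limits of vectors\<close>

lemma zero_in_tangent_space: "p \<in> S \<Longrightarrow> 0 \<in> tangent_space S p"
  unfolding tangent_space_def by (auto intro!: exI[of _ "\<lambda>_. p"] exI[of _ "\<lambda>_. 1 :: real"])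

text \<open>The gap bounds the distance from \<open>u\<close> to \<open>Ts m\<close>. That distance
  is an infimum, so the slack \<open>1 / Suc m\<close> is added in order to choose actual
  points.\<close>

lemma subspaces_converge_approx:
  assumes conv: "subspaces_converge Ts T" and 0: "\<And>m. 0 \<in> Ts m" and u: "u \<in> T" "norm u = 1"
  obtains y where "\<And>m. y m \<in> Ts m" "y \<longlonglongrightarrow> u"
proof -
  define g where "g m = subspace_gap (Ts m) T" for m
  have g: "g \<longlonglongrightarrow> 0" using conv by (simp add: subspaces_converge_def g_def[abs_def])
  have le: "infdist u (Ts m) \<le> g m" for m
  proof -
    have "bdd_above ((\<lambda>v. infdist v (Ts m)) ` (T \<inter> sphere 0 1))"
    proof (rule bdd_aboveI2)
      fix v :: 'a assume "v \<in> T \<inter> sphere 0 1"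
      then show "infdist v (Ts m) \<le> 1" using infdist_le[OF 0[of m], of v] by simp
    qed
    then have "infdist u (Ts m) \<le> (SUP v\<in>T \<inter> sphere 0 1. infdist v (Ts m))"
      using u by (intro cSUP_upper) auto
    then show ?thesis by (simp add: g_def subspace_gap_def)
  qed
  have "\<exists>y. \<forall>m. y m \<in> Ts m \<and> dist u (y m) < g m + 1 / real (Suc m)"
  proof (rule choice, rule allI)
    fix m
    have "infdist u (Ts m) < g m + 1 / real (Suc m)"
      using le[of m] by (intro less_le_trans[OF less_add_same_cancel1[THEN iffD2] add_right_mono]) auto
    then show "\<exists>y. y \<in> Ts m \<and> dist u y < g m + 1 / real (Suc m)"
    proof -
      have ne: "Ts m \<noteq> {}" using 0[of m] by blast
      have bdd: "bdd_below (dist u ` Ts m)" by (rule bdd_belowI[of _ 0]) auto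
      have "(INF a\<in>Ts m. dist u a) < g m + 1 / real (Suc m)"
        using \<open>infdist u (Ts m) < _\<close> unfolding infdist_notempty[OF ne] .
      then show ?thesis unfolding cINF_less_iff[OF ne bdd] by blast
    qed
  qed
  then obtain y where y: "\<And>m. y m \<in> Ts m" "\<And>m. dist u (y m) < g m + 1 / real (Suc m)" by blast
  have lim0: "(\<lambda>m. g m + 1 / real (Suc m)) \<longlonglongrightarrow> 0"
    using tendsto_add[OF g LIMSEQ_Suc[OF lim_1_over_n]] by simp
  have "norm (dist (y m) u) \<le> g m + 1 / real (Suc m)" for m
    using less_imp_le[OF y(2)[of m]] by (simp add: dist_commute)
  then have "(\<lambda>m. dist (y m) u) \<longlonglongrightarrow> 0"
    by (intro Lim_null_comparison[OF _ lim0] always_eventually allI)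
  then have "y \<longlonglongrightarrow> u" by (rule tendsto_dist_iff[THEN iffD2])
  with y(1) show ?thesis by (rule that)
qed

section \<open>Limits of conormals in a Newton-admissible family\<close>

locale newton_family =
  fixes k0 :: nat and F :: "nat \<Rightarrow> 'n::finite tzpoly" and R \<epsilon> :: real
  assumes poly: "\<And>k. k \<in> {1..k0} \<Longrightarrow> is_tzpoly (F k)"
    and eps: "\<epsilon> > 0"
    and boundary: "\<And>k t. k \<in> {1..k0} \<Longrightarrow> norm t < \<epsilon> \<Longrightarrow>
      newton_boundary (slice (F k) t) = newton_boundary (slice (F k) 0)"
    and nondeg: "\<And>K t. norm t < \<epsilon> \<Longrightarrow> K \<noteq> {} \<Longrightarrow> K \<subseteq> {1..k0} \<Longrightarrow> nondegenerate K (\<lambda>k. slice (F k) t)"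
    and tame: "\<And>K t. norm t < \<epsilon> \<Longrightarrow> K \<noteq> {} \<Longrightarrow> K \<subseteq> {1..k0} \<Longrightarrow>
      \<exists>R'>R. tame_radius K (\<lambda>k. slice (F k) t) R'"
begin

section \<open>Face functions of the family as limits of rescaled values\<close>

definition fval :: "nat \<Rightarrow> complex \<times> (complex^'n) \<Rightarrow> complex" where
  "fval k x = tzeval (F k) x"

definition face_val :: "nat^'n \<Rightarrow> nat \<Rightarrow> complex \<Rightarrow> complex^'n \<Rightarrow> complex" where
  "face_val w k t b = zeval (face_fun w (slice (F k) t)) b"

text \<open>Logarithmic derivatives of the face function. On the torus they carry the same
  information as the ordinary ones, and they occur as limits at the same scale as the
  values.\<close>

definition face_log :: "nat^'n \<Rightarrow> nat \<Rightarrow> complex \<Rightarrow> complex^'n \<Rightarrow> 'n \<Rightarrow> complex" where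
  "face_log w k t b i = b $ i * face_grad w (slice (F k) t) b $ i"

lemma face_log_sum_eq_0:
  assumes "b \<in> torus"
  shows "(\<Sum>k\<in>K. l k * face_log w k t b i) = 0 \<longleftrightarrow> (\<Sum>k\<in>K. l k * face_grad w (slice (F k) t) b $ i) = 0"
proof -
  have "(\<Sum>k\<in>K. l k * face_log w k t b i) = b $ i * (\<Sum>k\<in>K. l k * face_grad w (slice (F k) t) b $ i)"
    by (simp add: face_log_def sum_distrib_left mult_ac)
  then show ?thesis using assms by (simp add: torus_def)
qed

lemma fval_eq: "k \<in> {1..k0} \<Longrightarrow> fval k x = (\<Sum>\<alpha>\<in>tsupp (F k). slice (F k) (fst x) \<alpha> * zmon (snd x) \<alpha>)"
  by (simp add: fval_def tzeval_eq poly)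

lemma face_val_eq:
  assumes "k \<in> {1..k0}" "norm t < \<epsilon>"
  shows "face_val w k t b = (\<Sum>\<alpha>\<in>tsupp (F k). slice (F k) t \<alpha> * (if \<forall>\<beta>\<in>tsupp (F k). wt w \<alpha> \<le> wt w \<beta> then zmon b \<alpha> else 0))"
  using face_sum[OF poly[OF assms(1)] eps boundary[OF assms(1)] assms(2), of w "zmon b"]
  by (simp add: face_val_def zeval_def zmon_def)

lemma face_log_eq:
  assumes "k \<in> {1..k0}" "norm t < \<epsilon>"
  shows "face_log w k t b i = (\<Sum>\<alpha>\<in>tsupp (F k). slice (F k) t \<alpha> *
    (of_nat (\<alpha> $ i) * (if \<forall>\<beta>\<in>tsupp (F k). wt w \<alpha> \<le> wt w \<beta> then zmon b \<alpha> else 0)))"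
proof -
  let ?g = "face_fun w (slice (F k) t)"
  have "finite {\<alpha>. ?g \<alpha> \<noteq> 0}"
    by (rule finite_subset[OF _ finite_slice_support[OF poly[OF assms(1)], of t]]) (auto simp: face_fun_def)
  then have "face_log w k t b i = (\<Sum>\<alpha>\<in>{\<alpha>. ?g \<alpha> \<noteq> 0}. ?g \<alpha> * (of_nat (\<alpha> $ i) * zmon b \<alpha>))"
    by (simp add: face_log_def face_grad_def partial_zeval)
  also have "\<dots> = (\<Sum>\<alpha>\<in>tsupp (F k). slice (F k) t \<alpha> *
      (if \<forall>\<beta>\<in>tsupp (F k). wt w \<alpha> \<le> wt w \<beta> then of_nat (\<alpha> $ i) * zmon b \<alpha> else 0))"
    by (rule face_sum[OF poly[OF assms(1)] eps boundary[OF assms(1)] assms(2)])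
  finally show ?thesis by (simp add: if_distrib cong: if_cong)
qed

text \<open>Euler's identity: all exponents of the face function have the same weight, so it is
  weighted homogeneous of degree \<open>wt w a\<close>.\<close>

lemma euler_face:
  assumes "k \<in> {1..k0}" "norm t < \<epsilon>" "a \<in> tsupp (F k)" "\<And>\<beta>. \<beta> \<in> tsupp (F k) \<Longrightarrow> wt w a \<le> wt w \<beta>"
  shows "(\<Sum>i\<in>UNIV. of_nat (w $ i) * face_log w k t b i) = of_nat (wt w a) * face_val w k t b"
proof -
  let ?m = "\<lambda>\<alpha>. \<forall>\<beta>\<in>tsupp (F k). wt w \<alpha> \<le> wt w \<beta>"
  have "(\<Sum>i\<in>UNIV. of_nat (w $ i) * face_log w k t b i)
     = (\<Sum>\<alpha>\<in>tsupp (F k). \<Sum>i\<in>UNIV. of_nat (w $ i) * (slice (F k) t \<alpha> * (of_nat (\<alpha> $ i) * (if ?m \<alpha> then zmon b \<alpha> else 0))))"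
    unfolding face_log_eq[OF assms(1,2)] sum_distrib_left by (rule sum.swap)
  also have "\<dots> = (\<Sum>\<alpha>\<in>tsupp (F k). of_nat (wt w a) * (slice (F k) t \<alpha> * (if ?m \<alpha> then zmon b \<alpha> else 0)))"
  proof (intro sum.cong refl)
    fix \<alpha> assume \<alpha>: "\<alpha> \<in> tsupp (F k)"
    have "(\<Sum>i\<in>UNIV. of_nat (w $ i) * (slice (F k) t \<alpha> * (of_nat (\<alpha> $ i) * (if ?m \<alpha> then zmon b \<alpha> else 0))))
      = of_nat (wt w \<alpha>) * (slice (F k) t \<alpha> * (if ?m \<alpha> then zmon b \<alpha> else 0))"
    proof -
      have "(\<Sum>i\<in>UNIV. of_nat (w $ i) * (s * (of_nat (\<alpha> $ i) * e))) = of_nat (wt w \<alpha>) * (s * e)" for s e :: complex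
        by (simp add: wt_def sum_distrib_left mult_ac)
      then show ?thesis .
    qed
    moreover have "wt w \<alpha> = wt w a" if "?m \<alpha>" using that assms(3) assms(4)[OF \<alpha>] by (simp add: le_antisym)
    ultimately show "(\<Sum>i\<in>UNIV. of_nat (w $ i) * (slice (F k) t \<alpha> * (of_nat (\<alpha> $ i) * (if ?m \<alpha> then zmon b \<alpha> else 0))))
      = of_nat (wt w a) * (slice (F k) t \<alpha> * (if ?m \<alpha> then zmon b \<alpha> else 0))" by auto
  qed
  also have "\<dots> = of_nat (wt w a) * face_val w k t b"
    by (simp add: face_val_eq[OF assms(1,2)] sum_distrib_left)
  finally show ?thesis .
qed

text \<open>Values, logarithmic derivatives and the \<open>t\<close>-derivative are finite sums over
  the same monomials, with coefficients that converge, so one scale \<open>N\<close> per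
  \<open>k\<close> serves all three. The data \<open>r\<close>, \<open>w\<close> and
  \<open>b\<close> are common to all \<open>k\<close> because the asymptotics are taken on the union
  of the supports. For the \<open>t\<close>-derivative it is enough that some limit exists.\<close>

lemma face_asymptotics:
  assumes x: "x \<longlonglongrightarrow> (\<tau>, q)" and \<tau>: "norm \<tau> < \<epsilon>"
  obtains r w b where "strict_mono r" "b \<in> torus" "\<And>i. w $ i = 0 \<longleftrightarrow> q $ i \<noteq> 0" "\<And>i. q $ i \<noteq> 0 \<Longrightarrow> b $ i = q $ i"
    "\<And>k m \<alpha>. k \<in> {1..k0} \<Longrightarrow> \<alpha> \<in> tsupp (F k) \<Longrightarrow> zmon (snd (x (r m))) \<alpha> \<noteq> 0 \<Longrightarrow>
      \<exists>N \<eta>. (\<forall>m. 0 < N m) \<and> (\<lambda>m. fval k (x (r m)) / of_real (N m)) \<longlonglongrightarrow> face_val w k \<tau> b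
        \<and> (\<forall>i. (\<lambda>m. snd (x (r m)) $ i * dz (F k) i (x (r m)) / of_real (N m)) \<longlonglongrightarrow> face_log w k \<tau> b i)
        \<and> (\<lambda>m. dt (F k) (x (r m)) / of_real (N m)) \<longlonglongrightarrow> \<eta>"
proof -
  define E where "E = (\<Union>k\<in>{1..k0}. tsupp (F k))"
  have finE: "finite E" unfolding E_def by (intro finite_UN_I finite_tsupp poly) auto
  have x1: "(\<lambda>m. fst (x m)) \<longlonglongrightarrow> \<tau>" and x2: "(\<lambda>m. snd (x m)) \<longlonglongrightarrow> q"
    using tendsto_fst[OF x] tendsto_snd[OF x] by simp_all
  obtain r w b where r: "strict_mono (r :: nat \<Rightarrow> nat)" and b: "\<And>i. b $ i \<noteq> 0" and w: "\<And>i. w $ i = 0 \<longleftrightarrow> q $ i \<noteq> 0"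
    and bq: "\<And>i. q $ i \<noteq> 0 \<Longrightarrow> b $ i = q $ i"
    and lim: "\<And>S m \<alpha>. S \<subseteq> E \<Longrightarrow> \<alpha> \<in> S \<Longrightarrow> zmon (snd (x (r m))) \<alpha> \<noteq> 0 \<Longrightarrow>
       \<exists>N :: nat \<Rightarrow> real. (\<forall>m. 0 < N m) \<and>
         (\<forall>\<alpha>\<in>S. (\<lambda>m. zmon (snd (x (r m))) \<alpha> / of_real (N m)) \<longlonglongrightarrow> (if \<forall>\<beta>\<in>S. wt w \<alpha> \<le> wt w \<beta> then zmon b \<alpha> else 0))"
    by (rule monomial_asymptotics[OF finE x2]) (rule that; assumption)
  have tr: "(\<lambda>m. fst (x (r m))) \<longlonglongrightarrow> \<tau>" using LIMSEQ_subseq_LIMSEQ[OF x1 r] by (simp add: o_def)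
  show ?thesis
  proof (rule that[OF r _ w bq])
    show "b \<in> torus" using b by (simp add: torus_def)
    fix k m \<alpha> assume k: "k \<in> {1..k0}" and \<alpha>: "\<alpha> \<in> tsupp (F k)" "zmon (snd (x (r m))) \<alpha> \<noteq> 0"
    have "tsupp (F k) \<subseteq> E" using k by (auto simp: E_def)
    from lim[OF this \<alpha>] obtain N :: "nat \<Rightarrow> real" where N: "\<forall>m. 0 < N m" and
      l: "\<And>\<alpha>. \<alpha> \<in> tsupp (F k) \<Longrightarrow> (\<lambda>m. zmon (snd (x (r m))) \<alpha> / of_real (N m)) \<longlonglongrightarrow>
           (if \<forall>\<beta>\<in>tsupp (F k). wt w \<alpha> \<le> wt w \<beta> then zmon b \<alpha> else 0)" by blast
    have "(\<lambda>m. \<Sum>\<alpha>\<in>tsupp (F k). slice (F k) (fst (x (r m))) \<alpha> * (zmon (snd (x (r m))) \<alpha> / of_real (N m))) \<longlonglongrightarrow> face_val w k \<tau> b"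
      unfolding face_val_eq[OF k \<tau>] by (intro tendsto_intros tr l)
    then have 1: "(\<lambda>m. fval k (x (r m)) / of_real (N m)) \<longlonglongrightarrow> face_val w k \<tau> b"
      by (simp add: fval_eq[OF k] sum_divide_distrib)
    have "(\<lambda>m. \<Sum>\<alpha>\<in>tsupp (F k). slice (F k) (fst (x (r m))) \<alpha> * (of_nat (\<alpha> $ i) * (zmon (snd (x (r m))) \<alpha> / of_real (N m)))) \<longlonglongrightarrow> face_log w k \<tau> b i" for i
      unfolding face_log_eq[OF k \<tau>] by (intro tendsto_intros tr l)
    then have 2: "\<forall>i. (\<lambda>m. snd (x (r m)) $ i * dz (F k) i (x (r m)) / of_real (N m)) \<longlonglongrightarrow> face_log w k \<tau> b i"
      by (simp add: dz_mult sum_divide_distrib)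
    have "(\<lambda>m. \<Sum>\<alpha>\<in>tsupp (F k). slice_d (F k) (fst (x (r m))) \<alpha> * (zmon (snd (x (r m))) \<alpha> / of_real (N m))) \<longlonglongrightarrow>
        (\<Sum>\<alpha>\<in>tsupp (F k). slice_d (F k) \<tau> \<alpha> * (if \<forall>\<beta>\<in>tsupp (F k). wt w \<alpha> \<le> wt w \<beta> then zmon b \<alpha> else 0))"
      (is "_ \<longlonglongrightarrow> ?\<eta>") by (intro tendsto_intros tr l)
    then have 3: "(\<lambda>m. dt (F k) (x (r m)) / of_real (N m)) \<longlonglongrightarrow> ?\<eta>"
      by (simp add: dt_def sum_divide_distrib)
    show "\<exists>N \<eta>. (\<forall>m. 0 < N m) \<and> (\<lambda>m. fval k (x (r m)) / of_real (N m)) \<longlonglongrightarrow> face_val w k \<tau> b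
        \<and> (\<forall>i. (\<lambda>m. snd (x (r m)) $ i * dz (F k) i (x (r m)) / of_real (N m)) \<longlonglongrightarrow> face_log w k \<tau> b i)
        \<and> (\<lambda>m. dt (F k) (x (r m)) / of_real (N m)) \<longlonglongrightarrow> \<eta>"
      using N 1 2 3 by blast
  qed
qed

text \<open>The differentials of the restrictions of the \<open>f\<^sup>k\<close> to the coordinate torus of \<open>x\<close> are independent.
  The condition is void unless all of them vanish at \<open>x\<close> but not identically on that torus.\<close>
definition regular_at :: "nat set \<Rightarrow> complex \<times> (complex^'n) \<Rightarrow> bool" where
  "regular_at K x \<longleftrightarrow> (\<forall>c. (\<forall>k\<in>K. fval k x = 0 \<and> (\<exists>\<alpha>\<in>tsupp (F k). zmon (snd x) \<alpha> \<noteq> 0)) \<longrightarrow>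
     (\<forall>i. snd x $ i \<noteq> 0 \<longrightarrow> (\<Sum>k\<in>K. c k * dz (F k) i x) = 0) \<longrightarrow> (\<forall>k\<in>K. c k = 0))"

text \<open>Otherwise there are points tending to the origin that carry nontrivial relations.
  Rescaled and normalised, the relations converge to a nontrivial one between face gradients at a
  torus point where the face functions vanish. As the limit point is 0, the weight is positive, and
  non-degeneracy is contradicted.\<close>

lemma eventually_regular:
  assumes K: "K \<subseteq> {1..k0}"
  shows "eventually (regular_at K) (nhds (0, 0))"
proof (rule ccontr)
  assume "\<not> ?thesis"
  then have "\<forall>m. \<exists>x. dist x (0, 0) < 1 / real (Suc m) \<and> \<not> regular_at K x"
    unfolding eventually_nhds_metric by (metis of_nat_0_less_iff zero_less_Suc zero_less_divide_1_iff)
  then obtain x where xd: "\<And>m. dist (x m) (0, 0) < 1 / real (Suc m)" and xr: "\<And>m. \<not> regular_at K (x m)" by metis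
  have x: "x \<longlonglongrightarrow> (0, 0)"
  proof (rule tendsto_dist_iff[THEN iffD2], rule Lim_null_comparison[OF always_eventually[OF allI] LIMSEQ_Suc[OF lim_1_over_n]])
    show "norm (dist (x m) (0, 0)) \<le> 1 / real (Suc m)" for m using xd[of m] by simp
  qed
  have "\<forall>m. \<exists>c. (\<forall>k\<in>K. fval k (x m) = 0 \<and> (\<exists>\<alpha>\<in>tsupp (F k). zmon (snd (x m)) \<alpha> \<noteq> 0)) \<and>
     (\<forall>i. snd (x m) $ i \<noteq> 0 \<longrightarrow> (\<Sum>k\<in>K. c k * dz (F k) i (x m)) = 0) \<and> (\<exists>k\<in>K. c k \<noteq> 0)"
    using xr unfolding regular_at_def by blast
  from choice[OF this] obtain c where f0: "\<And>m k. k \<in> K \<Longrightarrow> fval k (x m) = 0"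
    and mon: "\<And>m k. k \<in> K \<Longrightarrow> \<exists>\<alpha>\<in>tsupp (F k). zmon (snd (x m)) \<alpha> \<noteq> 0"
    and dep: "\<And>m i. snd (x m) $ i \<noteq> 0 \<Longrightarrow> (\<Sum>k\<in>K. c m k * dz (F k) i (x m)) = 0"
    and c0: "\<And>m. \<exists>k\<in>K. c m k \<noteq> 0" by blast
  have finK: "finite K" using K finite_subset by blast
  have Kne: "K \<noteq> {}" using c0 by blast
  have n0: "norm (0::complex) < \<epsilon>" using eps by simp
  obtain r w b where r: "strict_mono (r :: nat \<Rightarrow> nat)" and b: "b \<in> torus"
    and w: "\<And>i. w $ i = 0 \<longleftrightarrow> (0 :: complex^'n) $ i \<noteq> 0"
    and "\<And>i. (0 :: complex^'n) $ i \<noteq> 0 \<Longrightarrow> b $ i = 0 $ i"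
    and lim: "\<And>k m \<alpha>. k \<in> {1..k0} \<Longrightarrow> \<alpha> \<in> tsupp (F k) \<Longrightarrow> zmon (snd (x (r m))) \<alpha> \<noteq> 0 \<Longrightarrow>
      \<exists>N \<eta>. (\<forall>m. 0 < N m) \<and> (\<lambda>m. fval k (x (r m)) / of_real (N m)) \<longlonglongrightarrow> face_val w k 0 b
        \<and> (\<forall>i. (\<lambda>m. snd (x (r m)) $ i * dz (F k) i (x (r m)) / of_real (N m)) \<longlonglongrightarrow> face_log w k 0 b i)
        \<and> (\<lambda>m. dt (F k) (x (r m)) / of_real (N m)) \<longlonglongrightarrow> \<eta>"
    by (rule face_asymptotics[OF x n0]) (rule that; assumption)
  have "\<forall>k\<in>K. \<exists>N. (\<forall>m. 0 < N m) \<and> (\<lambda>m. fval k (x (r m)) / of_real (N m)) \<longlonglongrightarrow> face_val w k 0 b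
        \<and> (\<forall>i. (\<lambda>m. snd (x (r m)) $ i * dz (F k) i (x (r m)) / of_real (N m)) \<longlonglongrightarrow> face_log w k 0 b i)"
  proof
    fix k assume k: "k \<in> K"
    obtain \<alpha> where "\<alpha> \<in> tsupp (F k)" "zmon (snd (x (r 0))) \<alpha> \<noteq> 0" using mon[OF k] by blast
    with lim[of k] k K show "\<exists>N. (\<forall>m. 0 < N m) \<and> (\<lambda>m. fval k (x (r m)) / of_real (N m)) \<longlonglongrightarrow> face_val w k 0 b
        \<and> (\<forall>i. (\<lambda>m. snd (x (r m)) $ i * dz (F k) i (x (r m)) / of_real (N m)) \<longlonglongrightarrow> face_log w k 0 b i)"
      by blast
  qed
  from bchoice[OF this] obtain N where N: "\<And>k m. k \<in> K \<Longrightarrow> 0 < N k m"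
    and Nf: "\<And>k. k \<in> K \<Longrightarrow> (\<lambda>m. fval k (x (r m)) / of_real (N k m)) \<longlonglongrightarrow> face_val w k 0 b"
    and Nz: "\<And>k i. k \<in> K \<Longrightarrow> (\<lambda>m. snd (x (r m)) $ i * dz (F k) i (x (r m)) / of_real (N k m)) \<longlonglongrightarrow> face_log w k 0 b i"
    by blast
  have fv: "face_val w k 0 b = 0" if "k \<in> K" for k
    using Nf[OF that] f0[OF that] by (simp add: LIMSEQ_const_iff)
  \<comment> \<open>Absorbing \<open>N k\<close> into the coefficients turns the relation into one
    between convergent quantities; dividing by \<open>M\<close> fixes the sum of the absolute values
    at 1, so the limit is nontrivial.\<close>
  define C where "C m k = c (r m) k * of_real (N k m)" for m k
  define M where "M m = (\<Sum>k\<in>K. norm (C m k))" for m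
  have M0: "M m > 0" for m
  proof -
    obtain k where k: "k \<in> K" "c (r m) k \<noteq> 0" using c0 by blast
    then have "norm (C m k) > 0" using N[OF k(1), of m] by (simp add: C_def)
    then show ?thesis unfolding M_def using k(1) finK by (intro sum_pos2) auto
  qed
  define Y where "Y m k = C m k / of_real (M m)" for m k
  have Ysum: "(\<Sum>k\<in>K. norm (Y m k)) = 1" for m
  proof -
    have "(\<Sum>k\<in>K. norm (Y m k)) = (\<Sum>k\<in>K. norm (C m k)) / M m"
      using M0[of m] by (simp add: Y_def norm_divide flip: sum_divide_distrib)
    then show ?thesis using M0[of m] by (simp flip: M_def)
  qed
  have bnd: "\<exists>B. \<forall>m. norm (Y m k) \<le> B" if "k \<in> K" for k
  proof (intro exI allI)
    fix m
    show "norm (Y m k) \<le> 1" using member_le_sum[OF that, of "\<lambda>k. norm (Y m k)"] finK Ysum[of m] by simp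
  qed
  obtain s l where s: "strict_mono (s :: nat \<Rightarrow> nat)"
    and l: "\<And>k. k \<in> K \<Longrightarrow> (\<lambda>m. Y (s m) k) \<longlonglongrightarrow> l k"
    by (rule bounded_family_subseq[OF finK, of Y], erule bnd, (rule that; assumption))
  have "(\<lambda>m. \<Sum>k\<in>K. norm (Y (s m) k)) \<longlonglongrightarrow> (\<Sum>k\<in>K. norm (l k))" by (intro tendsto_intros l)
  then have lsum: "(\<Sum>k\<in>K. norm (l k)) = 1" by (simp add: Ysum LIMSEQ_const_iff)
  have "(\<Sum>k\<in>K. l k * face_log w k 0 b i) = 0" for i
  proof -
    have "(\<lambda>m. \<Sum>k\<in>K. Y (s m) k * (snd (x (r (s m))) $ i * dz (F k) i (x (r (s m))) / of_real (N k (s m)))) \<longlonglongrightarrow>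
        (\<Sum>k\<in>K. l k * face_log w k 0 b i)"
      using LIMSEQ_subseq_LIMSEQ[OF Nz s] by (intro tendsto_intros l) (simp_all add: o_def)
    moreover have "(\<Sum>k\<in>K. Y m k * (snd (x (r m)) $ i * dz (F k) i (x (r m)) / of_real (N k m))) = 0" for m
    proof -
      have "(\<Sum>k\<in>K. Y m k * (snd (x (r m)) $ i * dz (F k) i (x (r m)) / of_real (N k m)))
         = (\<Sum>k\<in>K. snd (x (r m)) $ i / of_real (M m) * (c (r m) k * dz (F k) i (x (r m))))"
        using N by (intro sum.cong refl) (simp add: Y_def C_def less_imp_neq[symmetric])
      also have "\<dots> = snd (x (r m)) $ i / of_real (M m) * (\<Sum>k\<in>K. c (r m) k * dz (F k) i (x (r m)))"
        by (simp add: sum_distrib_left)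
      \<comment> \<open>The relation is given at nonzero coordinates; at the others the factor in
        front is 0.\<close>
      also have "\<dots> = 0" using dep[of "r m" i] by (cases "snd (x (r m)) $ i = 0") auto
      finally show ?thesis .
    qed
    ultimately show ?thesis by (simp add: LIMSEQ_const_iff)
  qed
  then have "(\<Sum>k\<in>K. l k * face_grad w (slice (F k) 0) b $ i) = 0" for i
    by (simp add: face_log_sum_eq_0[OF b])
  moreover have "cindep_on UNIV K (\<lambda>k. face_grad w (slice (F k) 0) b)"
    using nondeg[of 0 K] eps Kne K w b fv unfolding nondegenerate_def face_val_def by auto
  ultimately have "\<forall>k\<in>K. l k = 0" unfolding cindep_on_def by blast
  then show False using lsum by simp
qed

section \<open>The logarithmic differential of the product and its limits\<close>

definition log_diff :: "complex \<times> (complex^'n) \<Rightarrow> complex \<times> (complex^'n)" where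
  "log_diff x = (\<Sum>k\<in>{1..k0}. dt (F k) x / fval k x, \<chi> i. \<Sum>k\<in>{1..k0}. dz (F k) i x / fval k x)"

lemma tendsto_fval: "k \<in> {1..k0} \<Longrightarrow> (f \<longlongrightarrow> x) A \<Longrightarrow> ((\<lambda>m. fval k (f m)) \<longlongrightarrow> fval k x) A"
  unfolding fval_eq by (intro tendsto_intros)

text \<open>The indices split into \<open>K1\<close>, where every monomial vanishes at
  \<open>q\<close>, those with nonzero value at the limit point, and the remaining
  \<open>K2\<close>. The first two kinds receive coefficient 0 in the limit, so on \<open>v\<close>
  the limit covector is a combination of differentials that annihilate \<open>v\<close>.\<close>

lemma limit_conormal:
  assumes x: "x \<longlonglongrightarrow> (\<tau>, q)" and \<tau>: "norm \<tau> < \<epsilon>" and q: "(\<Sum>i\<in>UNIV. (norm (q $ i))\<^sup>2) < R"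
    and f0: "\<And>k m. k \<in> {1..k0} \<Longrightarrow> fval k (x m) \<noteq> 0"
    and reg: "\<And>K. K \<subseteq> {1..k0} \<Longrightarrow> regular_at K (\<tau>, q)"
    and kz: "kz \<in> {1..k0}" "fval kz (\<tau>, q) = 0"
    and v0: "\<And>i. q $ i = 0 \<Longrightarrow> snd v $ i = 0"
    and vk: "\<And>k. k \<in> {1..k0} \<Longrightarrow> fval k (\<tau>, q) = 0 \<Longrightarrow> cpair (dt (F k) (\<tau>, q), \<chi> i. dz (F k) i (\<tau>, q)) v = 0"
  obtains r a and M :: "nat \<Rightarrow> real" where "strict_mono (r :: nat \<Rightarrow> nat)" "a \<noteq> 0" "\<And>m. M m > 0"
    "(\<lambda>m. (1 / M m) *\<^sub>R log_diff (x (r m))) \<longlonglongrightarrow> a" "cpair a v = 0"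
proof -
  define KK where "KK = {1..k0}"
  have finKK: "finite KK" by (simp add: KK_def)
  obtain r1 w b where r1: "strict_mono (r1 :: nat \<Rightarrow> nat)" and b: "b \<in> torus" and w: "\<And>i. w $ i = 0 \<longleftrightarrow> q $ i \<noteq> 0"
    and bq: "\<And>i. q $ i \<noteq> 0 \<Longrightarrow> b $ i = q $ i"
    and lim: "\<And>k m \<alpha>. k \<in> {1..k0} \<Longrightarrow> \<alpha> \<in> tsupp (F k) \<Longrightarrow> zmon (snd (x (r1 m))) \<alpha> \<noteq> 0 \<Longrightarrow>
      \<exists>N \<eta>. (\<forall>m. 0 < N m) \<and> (\<lambda>m. fval k (x (r1 m)) / of_real (N m)) \<longlonglongrightarrow> face_val w k \<tau> b
        \<and> (\<forall>i. (\<lambda>m. snd (x (r1 m)) $ i * dz (F k) i (x (r1 m)) / of_real (N m)) \<longlonglongrightarrow> face_log w k \<tau> b i)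
        \<and> (\<lambda>m. dt (F k) (x (r1 m)) / of_real (N m)) \<longlonglongrightarrow> \<eta>"
    by (rule face_asymptotics[OF x \<tau>]) (rule that; assumption)
  define u where "u = x \<circ> r1"
  have u: "u \<longlonglongrightarrow> (\<tau>, q)" unfolding u_def using x r1 by (rule LIMSEQ_subseq_LIMSEQ)
  have uz: "(\<lambda>m. snd (u m) $ i) \<longlonglongrightarrow> q $ i" for i
    using tendsto_vec_nth[OF tendsto_snd[OF u]] by simp
  have uf: "fval k (u m) \<noteq> 0" if "k \<in> KK" for k m using f0 that by (simp add: u_def KK_def)
  have mon: "\<exists>\<alpha>\<in>tsupp (F k). zmon (snd (u m)) \<alpha> \<noteq> 0" if k: "k \<in> KK" for k m
  proof (rule ccontr)
    assume "\<not> ?thesis"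
    then have "fval k (u m) = 0" using k by (simp add: fval_eq KK_def)
    with uf[OF k] show False by blast
  qed
  define K1 where "K1 = {k\<in>KK. \<forall>\<alpha>\<in>tsupp (F k). zmon q \<alpha> = 0}"
  \<comment> \<open>\<open>\<phi>\<close> and \<open>\<psi>\<close> are the limits of values and
    logarithmic derivatives after scaling: face data at \<open>b\<close> for \<open>K1\<close>,
    otherwise the ordinary data at the limit point, with scale 1.\<close>
  define \<phi> where "\<phi> k = (if k \<in> K1 then face_val w k \<tau> b else fval k (\<tau>, q))" for k
  define \<psi> where "\<psi> k i = (if k \<in> K1 then face_log w k \<tau> b i else q $ i * dz (F k) i (\<tau>, q))" for k i
  have "\<forall>k\<in>KK. \<exists>p. (\<forall>m. 0 < fst p m) \<and> (\<lambda>m. fval k (u m) / of_real (fst p m)) \<longlonglongrightarrow> \<phi> k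
        \<and> (\<forall>i. (\<lambda>m. snd (u m) $ i * dz (F k) i (u m) / of_real (fst p m)) \<longlonglongrightarrow> \<psi> k i)
        \<and> (\<lambda>m. dt (F k) (u m) / of_real (fst p m)) \<longlonglongrightarrow> snd p
        \<and> (k \<notin> K1 \<longrightarrow> snd p = dt (F k) (\<tau>, q))"
  proof
    fix k assume k: "k \<in> KK"
    show "\<exists>p. (\<forall>m. 0 < fst p m) \<and> (\<lambda>m. fval k (u m) / of_real (fst p m)) \<longlonglongrightarrow> \<phi> k
        \<and> (\<forall>i. (\<lambda>m. snd (u m) $ i * dz (F k) i (u m) / of_real (fst p m)) \<longlonglongrightarrow> \<psi> k i)
        \<and> (\<lambda>m. dt (F k) (u m) / of_real (fst p m)) \<longlonglongrightarrow> snd p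
        \<and> (k \<notin> K1 \<longrightarrow> snd p = dt (F k) (\<tau>, q))"
    proof (cases "k \<in> K1")
      case True
      obtain \<alpha> where "\<alpha> \<in> tsupp (F k)" "zmon (snd (x (r1 0))) \<alpha> \<noteq> 0" using mon[OF k, of 0] by (auto simp: u_def)
      from lim[OF _ this] k obtain N \<eta> where "\<forall>m. 0 < N m" "(\<lambda>m. fval k (x (r1 m)) / of_real (N m)) \<longlonglongrightarrow> face_val w k \<tau> b"
        "\<forall>i. (\<lambda>m. snd (x (r1 m)) $ i * dz (F k) i (x (r1 m)) / of_real (N m)) \<longlonglongrightarrow> face_log w k \<tau> b i"
        "(\<lambda>m. dt (F k) (x (r1 m)) / of_real (N m)) \<longlonglongrightarrow> \<eta>" unfolding KK_def by blast
      then show ?thesis using True by (intro exI[of _ "(N, \<eta>)"]) (simp add: \<phi>_def \<psi>_def u_def)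
    next
      case False
      have "(\<lambda>m. fval k (u m)) \<longlonglongrightarrow> fval k (\<tau>, q)" using k u by (intro tendsto_fval) (auto simp: KK_def)
      moreover have "(\<lambda>m. snd (u m) $ i * dz (F k) i (u m)) \<longlonglongrightarrow> q $ i * dz (F k) i (\<tau>, q)" for i
        by (intro tendsto_mult uz tendsto_dz u)
      moreover have "(\<lambda>m. dt (F k) (u m)) \<longlonglongrightarrow> dt (F k) (\<tau>, q)" by (intro tendsto_dt u)
      ultimately show ?thesis using False
        by (intro exI[of _ "(\<lambda>_. 1, dt (F k) (\<tau>, q))"]) (simp add: \<phi>_def \<psi>_def)
    qed
  qed
  from bchoice[OF this] obtain p where p: "\<forall>k\<in>KK. (\<forall>m. 0 < fst (p k) m) \<and> (\<lambda>m. fval k (u m) / of_real (fst (p k) m)) \<longlonglongrightarrow> \<phi> k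
        \<and> (\<forall>i. (\<lambda>m. snd (u m) $ i * dz (F k) i (u m) / of_real (fst (p k) m)) \<longlonglongrightarrow> \<psi> k i)
        \<and> (\<lambda>m. dt (F k) (u m) / of_real (fst (p k) m)) \<longlonglongrightarrow> snd (p k)
        \<and> (k \<notin> K1 \<longrightarrow> snd (p k) = dt (F k) (\<tau>, q))" by blast
  define N where "N k = fst (p k)" for k
  define \<eta> where "\<eta> k = snd (p k)" for k
  have N: "0 < N k m" if "k \<in> KK" for k m using p that by (simp add: N_def)
  have Nf: "(\<lambda>m. fval k (u m) / of_real (N k m)) \<longlonglongrightarrow> \<phi> k" if "k \<in> KK" for k using p that by (simp add: N_def)
  have Nz: "(\<lambda>m. snd (u m) $ i * dz (F k) i (u m) / of_real (N k m)) \<longlonglongrightarrow> \<psi> k i" if "k \<in> KK" for k i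
    using p that by (simp add: N_def)
  have Nt: "(\<lambda>m. dt (F k) (u m) / of_real (N k m)) \<longlonglongrightarrow> \<eta> k" if "k \<in> KK" for k using p that by (simp add: N_def \<eta>_def)
  have \<eta>: "\<eta> k = dt (F k) (\<tau>, q)" if "k \<in> KK - K1" for k using p that by (simp add: \<eta>_def)
  \<comment> \<open>With these coefficients, each coordinate times the matching component of
    \<open>log_diff\<close> becomes the sum of \<open>Y m k\<close> times a convergent
    quantity.\<close>
  define Y where "Y m k = of_real (N k m) / fval k (u m)" for m k
  define om where "om m = log_diff (u m)" for m
  \<comment> \<open>Including 1 and all coefficients keeps every normalised quantity bounded and
    makes their norms sum to 1, so the limits \<open>e\<close> of \<open>1 / M\<close>,
    \<open>y\<close> and \<open>a\<close> cannot all vanish.\<close>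
  define M where "M m = 1 + (\<Sum>k\<in>KK. norm (Y m k)) + norm (om m)" for m
  have M1: "M m \<ge> 1" for m by (simp add: M_def sum_nonneg)
  have M0: "M m > 0" for m using M1[of m] by linarith
  have Yle: "norm (Y m k / of_real (M m)) \<le> 1" if "k \<in> KK" for m k
  proof -
    have "norm (Y m k) \<le> (\<Sum>k\<in>KK. norm (Y m k))" using that finKK by (intro member_le_sum) auto
    also have "\<dots> \<le> M m" by (simp add: M_def)
    finally show ?thesis using M0[of m] by (simp add: norm_divide)
  qed
  have omle: "norm (om m) \<le> M m" for m by (simp add: M_def sum_nonneg)
  define Z where "Z m = (1 / M m, (1 / M m) *\<^sub>R om m)" for m
  have "norm (Z m) \<le> 2" for m
  proof -
    have "norm (Z m) \<le> norm (1 / M m) + norm ((1 / M m) *\<^sub>R om m)" unfolding Z_def by (rule norm_Pair_le)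
    also have "\<dots> \<le> 1 + 1" using M1[of m] M0[of m] omle[of m] by (intro add_mono) (auto simp: field_simps)
    finally show ?thesis by simp
  qed
  then have "bounded (range Z)" unfolding bounded_iff by blast
  then obtain Zl r2 where r2: "strict_mono (r2 :: nat \<Rightarrow> nat)" and Zl: "(Z \<circ> r2) \<longlonglongrightarrow> Zl"
    using bounded_imp_convergent_subsequence by blast
  define Yr where "Yr m k = Y (r2 m) k / of_real (M (r2 m))" for m k
  have bnd: "\<exists>B. \<forall>m. norm (Yr m k) \<le> B" if "k \<in> KK" for k
    unfolding Yr_def using Yle[OF that] by blast
  obtain r3 y where r3: "strict_mono (r3 :: nat \<Rightarrow> nat)" and y: "\<And>k. k \<in> KK \<Longrightarrow> (\<lambda>m. Yr (r3 m) k) \<longlonglongrightarrow> y k"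
    by (rule bounded_family_subseq[OF finKK, of Yr], erule bnd, (rule that; assumption))
  define s where "s = r2 \<circ> r3"
  have s: "strict_mono s" unfolding s_def using r2 r3 by (rule strict_mono_o)
  define e where "e = fst Zl"
  define a where "a = snd Zl"
  have Zs: "(\<lambda>m. Z (s m)) \<longlonglongrightarrow> Zl" using LIMSEQ_subseq_LIMSEQ[OF Zl r3] by (simp add: o_def s_def)
  have e: "(\<lambda>m. 1 / M (s m)) \<longlonglongrightarrow> e" using tendsto_fst[OF Zs] by (simp add: Z_def e_def)
  have a: "(\<lambda>m. (1 / M (s m)) *\<^sub>R om (s m)) \<longlonglongrightarrow> a" using tendsto_snd[OF Zs] by (simp add: Z_def a_def)
  have y: "(\<lambda>m. Y (s m) k / of_real (M (s m))) \<longlonglongrightarrow> y k" if "k \<in> KK" for k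
    using y[OF that] by (simp add: Yr_def s_def)
  have Nfs: "(\<lambda>m. fval k (u (s m)) / of_real (N k (s m))) \<longlonglongrightarrow> \<phi> k" if "k \<in> KK" for k
    using LIMSEQ_subseq_LIMSEQ[OF Nf[OF that] s] by (simp add: o_def)
  have Nzs: "(\<lambda>m. snd (u (s m)) $ i * dz (F k) i (u (s m)) / of_real (N k (s m))) \<longlonglongrightarrow> \<psi> k i" if "k \<in> KK" for k i
    using LIMSEQ_subseq_LIMSEQ[OF Nz[OF that] s] by (simp add: o_def)
  have Nts: "(\<lambda>m. dt (F k) (u (s m)) / of_real (N k (s m))) \<longlonglongrightarrow> \<eta> k" if "k \<in> KK" for k
    using LIMSEQ_subseq_LIMSEQ[OF Nt[OF that] s] by (simp add: o_def)
  have uzs: "(\<lambda>m. snd (u (s m)) $ i) \<longlonglongrightarrow> q $ i" for i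
    using LIMSEQ_subseq_LIMSEQ[OF uz s] by (simp add: o_def)
  have total: "e + (\<Sum>k\<in>KK. norm (y k)) + norm a = 1"
  proof -
    have "(\<lambda>m. 1 / M (s m) + (\<Sum>k\<in>KK. norm (Y (s m) k / of_real (M (s m)))) + norm ((1 / M (s m)) *\<^sub>R om (s m)))
        \<longlonglongrightarrow> e + (\<Sum>k\<in>KK. norm (y k)) + norm a"
      by (intro tendsto_add tendsto_sum tendsto_norm e a y)
    moreover have "1 / M m + (\<Sum>k\<in>KK. norm (Y m k / of_real (M m))) + norm ((1 / M m) *\<^sub>R om m) = 1" for m
    proof -
      have "1 / M m + (\<Sum>k\<in>KK. norm (Y m k / of_real (M m))) + norm ((1 / M m) *\<^sub>R om m)
         = (1 + (\<Sum>k\<in>KK. norm (Y m k)) + norm (om m)) / M m"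
        using M0[of m] by (simp add: norm_divide add_divide_distrib flip: sum_divide_distrib)
      also have "\<dots> = 1" using M0[of m] by (simp flip: M_def)
      finally show ?thesis .
    qed
    ultimately show ?thesis by (simp add: LIMSEQ_const_iff)
  qed
  \<comment> \<open>Coefficient times scaled value is exactly \<open>1 / M\<close>. Once
    \<open>e = 0\<close> is known, this forces \<open>y k = 0\<close> wherever
    \<open>\<phi> k\<close> is nonzero.\<close>
  have yphi: "y k * \<phi> k = of_real e" if k: "k \<in> KK" for k
  proof -
    have "(\<lambda>m. (Y (s m) k / of_real (M (s m))) * (fval k (u (s m)) / of_real (N k (s m)))) \<longlonglongrightarrow> y k * \<phi> k"
      by (intro tendsto_mult y Nfs k)
    moreover have "(Y m k / of_real (M m)) * (fval k (u m) / of_real (N k m)) = of_real (1 / M m)" for m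
      using N[OF k, of m] uf[OF k, of m] by (simp add: Y_def)
    ultimately have "(\<lambda>m. complex_of_real (1 / M (s m))) \<longlonglongrightarrow> y k * \<phi> k" by simp
    moreover have "(\<lambda>m. complex_of_real (1 / M (s m))) \<longlonglongrightarrow> of_real e" by (intro tendsto_of_real e)
    ultimately show ?thesis using LIMSEQ_unique by blast
  qed
  \<comment> \<open>At a coordinate with \<open>q $ i = 0\<close> the left side is 0: this is the
    source of the linear relations between the face gradients.\<close>
  have az: "q $ i * snd a $ i = (\<Sum>k\<in>KK. y k * \<psi> k i)" for i
  proof -
    have "(\<lambda>m. \<Sum>k\<in>KK. (Y (s m) k / of_real (M (s m))) * (snd (u (s m)) $ i * dz (F k) i (u (s m)) / of_real (N k (s m))))
        \<longlonglongrightarrow> (\<Sum>k\<in>KK. y k * \<psi> k i)"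
      by (intro tendsto_sum tendsto_mult y Nzs)
    moreover have "(\<Sum>k\<in>KK. (Y m k / of_real (M m)) * (snd (u m) $ i * dz (F k) i (u m) / of_real (N k m)))
        = snd (u m) $ i * snd ((1 / M m) *\<^sub>R om m) $ i" for m
    proof -
      have "(\<Sum>k\<in>KK. (Y m k / of_real (M m)) * (snd (u m) $ i * dz (F k) i (u m) / of_real (N k m)))
        = (\<Sum>k\<in>KK. snd (u m) $ i * (dz (F k) i (u m) / fval k (u m)) / of_real (M m))"
      proof (intro sum.cong refl)
        fix k assume "k \<in> KK"
        then show "(Y m k / of_real (M m)) * (snd (u m) $ i * dz (F k) i (u m) / of_real (N k m))
          = snd (u m) $ i * (dz (F k) i (u m) / fval k (u m)) / of_real (M m)"
          using N[of k m] by (simp add: Y_def)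
      qed
      moreover have "snd ((1 / M m) *\<^sub>R om m) $ i = snd (om m) $ i / of_real (M m)"
        by (simp only: snd_scaleR vector_scaleR_component scaleR_conv_of_real[where 'a = complex]) simp
      moreover have "snd (om m) $ i = (\<Sum>k\<in>KK. dz (F k) i (u m) / fval k (u m))"
        by (simp add: om_def log_diff_def KK_def)
      ultimately show ?thesis by (simp add: sum_distrib_left sum_divide_distrib)
    qed
    ultimately have "(\<lambda>m. snd (u (s m)) $ i * snd ((1 / M (s m)) *\<^sub>R om (s m)) $ i) \<longlonglongrightarrow> (\<Sum>k\<in>KK. y k * \<psi> k i)"
      by simp
    moreover have "(\<lambda>m. snd (u (s m)) $ i * snd ((1 / M (s m)) *\<^sub>R om (s m)) $ i) \<longlonglongrightarrow> q $ i * snd a $ i"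
      by (intro tendsto_mult uzs tendsto_vec_nth tendsto_snd a)
    ultimately show ?thesis using LIMSEQ_unique by blast
  qed
  have at: "fst a = (\<Sum>k\<in>KK. y k * \<eta> k)"
  proof -
    have "(\<lambda>m. \<Sum>k\<in>KK. (Y (s m) k / of_real (M (s m))) * (dt (F k) (u (s m)) / of_real (N k (s m))))
        \<longlonglongrightarrow> (\<Sum>k\<in>KK. y k * \<eta> k)"
      by (intro tendsto_sum tendsto_mult y Nts)
    moreover have "(\<Sum>k\<in>KK. (Y m k / of_real (M m)) * (dt (F k) (u m) / of_real (N k m)))
        = fst ((1 / M m) *\<^sub>R om m)" for m
    proof -
      have "(\<Sum>k\<in>KK. (Y m k / of_real (M m)) * (dt (F k) (u m) / of_real (N k m)))
        = (\<Sum>k\<in>KK. (dt (F k) (u m) / fval k (u m)) / of_real (M m))"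
      proof (intro sum.cong refl)
        fix k assume "k \<in> KK"
        then show "(Y m k / of_real (M m)) * (dt (F k) (u m) / of_real (N k m))
          = (dt (F k) (u m) / fval k (u m)) / of_real (M m)"
          using N[of k m] by (simp add: Y_def)
      qed
      moreover have "fst ((1 / M m) *\<^sub>R om m) = fst (om m) / of_real (M m)"
        by (simp only: fst_scaleR scaleR_conv_of_real) simp
      moreover have "fst (om m) = (\<Sum>k\<in>KK. dt (F k) (u m) / fval k (u m))"
        by (simp add: om_def log_diff_def KK_def)
      ultimately show ?thesis by (simp add: sum_divide_distrib)
    qed
    ultimately have "(\<lambda>m. fst ((1 / M (s m)) *\<^sub>R om (s m))) \<longlonglongrightarrow> (\<Sum>k\<in>KK. y k * \<eta> k)" by simp
    moreover have "(\<lambda>m. fst ((1 / M (s m)) *\<^sub>R om (s m))) \<longlonglongrightarrow> fst a"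
      by (intro tendsto_fst a)
    ultimately show ?thesis using LIMSEQ_unique by blast
  qed
  have \<psi>0: "\<psi> k i = 0" if "k \<notin> K1" "q $ i = 0" for k i using that by (simp add: \<psi>_def)
  have K1: "K1 \<subseteq> KK" by (auto simp: K1_def)
  \<comment> \<open>If \<open>kz\<close> is not in \<open>K1\<close>, its scaled value tends to 0
    and \<open>yphi\<close> gives the claim. Otherwise \<open>az\<close> is summed with the weights
    \<open>w\<close>: the left side vanishes because \<open>w\<close> and \<open>q\<close> have
    disjoint supports, and Euler's identity makes the right side \<open>e\<close> times a positive
    number.\<close>
  have e0: "e = 0"
  proof (cases "kz \<in> K1")
    case False
    then show ?thesis using yphi[of kz] kz by (simp add: \<phi>_def KK_def)
  next
    case True
    have "\<exists>d. d > 0 \<and> (\<Sum>i\<in>UNIV. of_nat (w $ i) * \<psi> k i) = of_nat d * \<phi> k" if k: "k \<in> K1" for k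
    proof -
      have kk: "k \<in> {1..k0}" using k K1 by (auto simp: KK_def)
      obtain \<alpha>0 where "\<alpha>0 \<in> tsupp (F k)" using mon[of k 0] k K1 by blast
      then obtain a where a: "a \<in> tsupp (F k)" "\<And>\<beta>. \<beta> \<in> tsupp (F k) \<Longrightarrow> wt w a \<le> wt w \<beta>"
        using ex_has_least_nat[of "\<lambda>x. x \<in> tsupp (F k)" \<alpha>0 "wt w"] by auto
      \<comment> \<open>Every exponent of a member of \<open>K1\<close> involves a coordinate where
        \<open>q\<close> is 0, and exactly there \<open>w\<close> is positive; so the degree in
        Euler's identity is positive.\<close>
      have "zmon q a = 0" using k a(1) by (simp add: K1_def)
      then obtain i where "q $ i = 0" "a $ i \<noteq> 0" by (auto simp: zmon_eq_0_iff)
      then have "w $ i * a $ i > 0" using w[of i] by simp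
      then have "wt w a > 0" unfolding wt_def by (intro sum_pos2[of _ i]) auto
      then show ?thesis using euler_face[OF kk \<tau> a] k by (intro exI[of _ "wt w a"]) (simp add: \<phi>_def \<psi>_def)
    qed
    then have "\<forall>k\<in>K1. \<exists>d. d > 0 \<and> (\<Sum>i\<in>UNIV. of_nat (w $ i) * \<psi> k i) = of_nat d * \<phi> k" by blast
    from bchoice[OF this] obtain d :: "nat \<Rightarrow> nat" where d0: "\<And>k. k \<in> K1 \<Longrightarrow> d k > 0"
      and d: "\<And>k. k \<in> K1 \<Longrightarrow> (\<Sum>i\<in>UNIV. of_nat (w $ i) * \<psi> k i) = of_nat (d k) * \<phi> k" by blast
    have "(\<Sum>i\<in>UNIV. of_nat (w $ i) * (q $ i * snd a $ i)) = 0"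
      by (intro sum.neutral ballI) (use w in auto)
    then have "0 = (\<Sum>i\<in>UNIV. of_nat (w $ i) * (\<Sum>k\<in>KK. y k * \<psi> k i))" by (simp add: az)
    also have "\<dots> = (\<Sum>k\<in>KK. y k * (\<Sum>i\<in>UNIV. of_nat (w $ i) * \<psi> k i))"
      unfolding sum_distrib_left by (subst sum.swap) (simp add: mult.left_commute)
    also have "\<dots> = (\<Sum>k\<in>K1. y k * (\<Sum>i\<in>UNIV. of_nat (w $ i) * \<psi> k i))"
    proof (rule sum.mono_neutral_right[OF finKK K1], intro ballI)
      fix k assume k: "k \<in> KK - K1"
      have "(\<Sum>i\<in>UNIV. of_nat (w $ i) * \<psi> k i) = 0"
        by (intro sum.neutral ballI) (use w \<psi>0[of k] k in auto)
      then show "y k * (\<Sum>i\<in>UNIV. of_nat (w $ i) * \<psi> k i) = 0" by simp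
    qed
    also have "\<dots> = (\<Sum>k\<in>K1. of_real (e * real (d k)))"
    proof (intro sum.cong refl)
      fix k assume k: "k \<in> K1"
      have "y k * (of_nat (d k) * \<phi> k) = of_nat (d k) * (y k * \<phi> k)" by simp
      then show "y k * (\<Sum>i\<in>UNIV. of_nat (w $ i) * \<psi> k i) = of_real (e * real (d k))"
        using d[OF k] yphi[of k] k K1 by (auto simp: mult.commute)
    qed
    also have "\<dots> = of_real (e * (\<Sum>k\<in>K1. real (d k)))" by (simp add: sum_distrib_left)
    finally have "e * (\<Sum>k\<in>K1. real (d k)) = 0" by (metis of_real_eq_0_iff)
    moreover have "(\<Sum>k\<in>K1. real (d k)) > 0"
      using True d0[OF True] finite_subset[OF K1 finKK] by (intro sum_pos2[of _ kz]) auto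
    ultimately show ?thesis by simp
  qed
  have yphi0: "y k = 0" if "k \<in> KK" "\<phi> k \<noteq> 0" for k using yphi[OF that(1)] that(2) e0 by simp
  \<comment> \<open>Only for these members of \<open>K1\<close> can \<open>y k\<close> still be
    nonzero, and their face functions vanish at \<open>b\<close>, as non-degeneracy and tameness
    require.\<close>
  define Ks where "Ks = {k\<in>K1. \<phi> k = 0}"
  have ysum: "(\<Sum>k\<in>Ks. y k * face_grad w (slice (F k) \<tau>) b $ i) = 0" if i: "q $ i = 0" for i
  proof -
    have "0 = (\<Sum>k\<in>KK. y k * \<psi> k i)" using az[of i] i by simp
    also have "\<dots> = (\<Sum>k\<in>Ks. y k * \<psi> k i)"
    proof (rule sum.mono_neutral_right[OF finKK])
      show "Ks \<subseteq> KK" using K1 by (auto simp: Ks_def)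
      show "\<forall>k\<in>KK - Ks. y k * \<psi> k i = 0"
        using yphi0 \<psi>0[OF _ i] by (auto simp: Ks_def)
    qed
    also have "\<dots> = (\<Sum>k\<in>Ks. y k * face_log w k \<tau> b i)" by (intro sum.cong refl) (simp add: \<psi>_def Ks_def)
    finally show ?thesis using face_log_sum_eq_0[OF b, of y w \<tau> i Ks] by simp
  qed
  have yKs: "y k = 0" if kKs: "k \<in> Ks" for k
  proof -
    have KsK: "Ks \<subseteq> {1..k0}" "Ks \<noteq> {}" using K1 kKs by (auto simp: Ks_def KK_def)
    have fv: "\<forall>k\<in>Ks. zeval (face_fun w (slice (F k) \<tau>)) b = 0"
      by (auto simp: Ks_def \<phi>_def face_val_def)
    define I where "I = {i. q $ i \<noteq> 0}"
    have wI: "{i. w $ i = 0} = I" using w by (auto simp: I_def)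
    \<comment> \<open>For \<open>I\<close> empty, that is \<open>q = 0\<close>, the weight is
      positive and non-degeneracy applies; otherwise local tameness for the coordinate set
      \<open>I\<close>.\<close>
    have "cindep_on (- I) Ks (\<lambda>k. face_grad w (slice (F k) \<tau>) b)"
    proof (cases "I = {}")
      case True
      then have "\<forall>i. 0 < w $ i" using w by (auto simp: I_def)
      then show ?thesis using nondeg[OF \<tau> KsK(2,1)] b fv True unfolding nondegenerate_def by simp
    next
      case False
      obtain R' where R': "R' > R" "tame_radius Ks (\<lambda>k. slice (F k) \<tau>) R'" using tame[OF \<tau> KsK(2,1)] by blast
      have van: "\<forall>k\<in>Ks. vanishes_on_coord (slice (F k) \<tau>) I"
        unfolding vanishes_on_coord_def
      proof (intro ballI allI impI)
        fix k and z :: "complex^'n" assume k: "k \<in> Ks" and z: "\<forall>i. i \<notin> I \<longrightarrow> z $ i = 0"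
        have "slice (F k) \<tau> \<alpha> * (\<Prod>i\<in>UNIV. z $ i ^ \<alpha> $ i) = 0" if "slice (F k) \<tau> \<alpha> \<noteq> 0" for \<alpha>
        proof -
          have "zmon q \<alpha> = 0" using k slice_support[OF that] by (simp add: Ks_def K1_def)
          then have "zmon z \<alpha> = 0" using z by (auto simp: zmon_eq_0_iff I_def)
          then show ?thesis by (simp add: zmon_def)
        qed
        then show "zeval (slice (F k) \<tau>) z = 0" unfolding zeval_def by (intro sum.neutral) auto
      qed
      \<comment> \<open>With \<open>w = 0\<close> no coordinate of \<open>q\<close>, and hence no
        monomial, would vanish at \<open>q\<close>; but a member of \<open>K1\<close> has at least
        one exponent, and its monomials all vanish there.\<close>
      have w0: "w \<noteq> 0"
      proof
        assume "w = 0"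
        then have "q $ i \<noteq> 0" for i using w[of i] by simp
        then have "zmon q \<alpha> \<noteq> 0" for \<alpha> by (simp add: zmon_eq_0_iff)
        then show False using kKs mon[of k 0] K1 by (auto simp: Ks_def K1_def)
      qed
      have lt: "(\<Sum>i\<in>I. (norm (b $ i))\<^sup>2) < R'"
      proof -
        have "(\<Sum>i\<in>I. (norm (b $ i))\<^sup>2) = (\<Sum>i\<in>I. (norm (q $ i))\<^sup>2)"
          by (intro sum.cong refl) (simp add: I_def bq)
        also have "\<dots> \<le> (\<Sum>i\<in>UNIV. (norm (q $ i))\<^sup>2)" by (intro sum_mono2) auto
        finally show ?thesis using q R'(1) by simp
      qed
      show ?thesis
        by (rule R'(2)[unfolded tame_radius_def, rule_format, of I w b]; (intro conjI)?; fact)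
    qed
    moreover have "\<forall>i\<in>- I. (\<Sum>k\<in>Ks. y k * face_grad w (slice (F k) \<tau>) b $ i) = 0" using ysum by (auto simp: I_def)
    ultimately show ?thesis using kKs unfolding cindep_on_def by blast
  qed
  define K2 where "K2 = {k\<in>KK - K1. fval k (\<tau>, q) = 0}"
  have y0: "y k = 0" if "k \<in> KK - K2" for k
    using that yphi0[of k] yKs[of k] by (cases "k \<in> K1") (auto simp: Ks_def K2_def \<phi>_def)
  have sumK2: "(\<Sum>k\<in>KK. y k * g k) = (\<Sum>k\<in>K2. y k * g k)" for g
    by (rule sum.mono_neutral_right[OF finKK]) (use y0 in \<open>auto simp: K2_def\<close>)
  have az2: "snd a $ i = (\<Sum>k\<in>K2. y k * dz (F k) i (\<tau>, q))" if i: "q $ i \<noteq> 0" for i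
  proof -
    have "q $ i * snd a $ i = (\<Sum>k\<in>K2. y k * \<psi> k i)" by (simp add: az sumK2)
    also have "\<dots> = (\<Sum>k\<in>K2. q $ i * (y k * dz (F k) i (\<tau>, q)))"
      by (intro sum.cong refl) (simp add: \<psi>_def K2_def)
    also have "\<dots> = q $ i * (\<Sum>k\<in>K2. y k * dz (F k) i (\<tau>, q))" by (simp add: sum_distrib_left)
    finally show ?thesis using i by simp
  qed
  have at2: "fst a = (\<Sum>k\<in>K2. y k * dt (F k) (\<tau>, q))"
    unfolding at sumK2 by (intro sum.cong refl) (simp add: \<eta> K2_def)
  \<comment> \<open>If \<open>a\<close> were 0, regularity at the limit point would kill the
    coefficients on \<open>K2\<close>; then \<open>e\<close>, \<open>y\<close> and \<open>a\<close>
    would all be 0, against \<open>total\<close>.\<close>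
  have a0: "a \<noteq> 0"
  proof
    assume a: "a = 0"
    have "regular_at K2 (\<tau>, q)" by (rule reg) (auto simp: K2_def KK_def)
    moreover have "\<forall>k\<in>K2. fval k (\<tau>, q) = 0 \<and> (\<exists>\<alpha>\<in>tsupp (F k). zmon (snd (\<tau>, q)) \<alpha> \<noteq> 0)"
      by (auto simp: K2_def K1_def)
    moreover have "\<forall>i. snd (\<tau>, q) $ i \<noteq> 0 \<longrightarrow> (\<Sum>k\<in>K2. y k * dz (F k) i (\<tau>, q)) = 0"
      using az2 a by simp
    ultimately have "\<forall>k\<in>K2. y k = 0" unfolding regular_at_def by blast
    then have "y k = 0" if "k \<in> KK" for k using y0[of k] that by blast
    then show False using total a e0 by simp
  qed
  \<comment> \<open>Where \<open>q $ i = 0\<close>, the component of \<open>a\<close> is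
    undetermined, but \<open>v\<close> has no component there.\<close>
  have av: "cpair a v = 0"
  proof -
    have "(\<Sum>i\<in>UNIV. snd a $ i * snd v $ i) = (\<Sum>i\<in>UNIV. \<Sum>k\<in>K2. y k * (dz (F k) i (\<tau>, q) * snd v $ i))"
    proof (intro sum.cong refl)
      fix i
      show "snd a $ i * snd v $ i = (\<Sum>k\<in>K2. y k * (dz (F k) i (\<tau>, q) * snd v $ i))"
        using v0[of i] az2[of i] by (cases "q $ i = 0") (auto simp: sum_distrib_right mult.assoc)
    qed
    also have "\<dots> = (\<Sum>k\<in>K2. \<Sum>i\<in>UNIV. y k * (dz (F k) i (\<tau>, q) * snd v $ i))" by (rule sum.swap)
    finally have "cpair a v = (\<Sum>k\<in>K2. y k * cpair (dt (F k) (\<tau>, q), \<chi> i. dz (F k) i (\<tau>, q)) v)"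
      by (simp add: cpair_def at2 sum_distrib_right sum_distrib_left distrib_left sum.distrib mult.assoc)
    also have "\<dots> = 0" by (intro sum.neutral) (use vk in \<open>auto simp: K2_def KK_def\<close>)
    finally show ?thesis .
  qed
  show ?thesis
  proof (rule that[of "r1 \<circ> s" a "\<lambda>m. M (s m)"])
    show "strict_mono (r1 \<circ> s)" using r1 s by (rule strict_mono_o)
    show "(\<lambda>m. (1 / M (s m)) *\<^sub>R log_diff (x ((r1 \<circ> s) m))) \<longlonglongrightarrow> a" using a by (simp add: om_def u_def)
  qed (use a0 M0 av in auto)
qed

section \<open>Level sets of the product and Thom's condition at a point\<close>

lemma fval_has_derivative:
  assumes "k \<in> {1..k0}"
  shows "(fval k has_derivative cpair (dt (F k) x, \<chi> i. dz (F k) i x)) (at x)"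
  using tzeval_has_derivative[OF poly[OF assms], of x]
  by (simp add: fval_def[abs_def] cpair_def[abs_def])

lemma fprod_has_derivative:
  assumes "\<And>k. k \<in> {1..k0} \<Longrightarrow> fval k x \<noteq> 0"
  shows "(fprod k0 F has_derivative (\<lambda>v. fprod k0 F x * cpair (log_diff x) v)) (at x)"
proof -
  define d where "d k = cpair (dt (F k) x, \<chi> i. dz (F k) i x)" for k
  have "((\<lambda>x. \<Prod>k\<in>{1..k0}. fval k x) has_derivative
      (\<lambda>v. \<Sum>k\<in>{1..k0}. d k v * (\<Prod>j\<in>{1..k0} - {k}. fval j x))) (at x)"
    unfolding d_def by (intro has_derivative_prod fval_has_derivative)
  moreover have "(\<Sum>k\<in>{1..k0}. d k v * (\<Prod>j\<in>{1..k0} - {k}. fval j x)) = fprod k0 F x * cpair (log_diff x) v" for v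
  proof -
    have "(\<Sum>k\<in>{1..k0}. d k v * (\<Prod>j\<in>{1..k0} - {k}. fval j x)) = (\<Sum>k\<in>{1..k0}. fprod k0 F x * (d k v / fval k x))"
    proof (intro sum.cong refl)
      fix k assume k: "k \<in> {1..k0}"
      have "fprod k0 F x = fval k x * (\<Prod>j\<in>{1..k0} - {k}. fval j x)"
        unfolding fprod_def fval_def using k by (intro prod.remove) auto
      then show "d k v * (\<Prod>j\<in>{1..k0} - {k}. fval j x) = fprod k0 F x * (d k v / fval k x)"
        using assms[OF k] by simp
    qed
    also have "\<dots> = fprod k0 F x * (\<Sum>k\<in>{1..k0}. d k v / fval k x)" by (rule sum_distrib_left[symmetric])
    also have "(\<Sum>k\<in>{1..k0}. d k v / fval k x) = cpair (log_diff x) v"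
    proof -
      have "(\<Sum>k\<in>{1..k0}. \<Sum>i\<in>UNIV. dz (F k) i x * snd v $ i / fval k x) = (\<Sum>i\<in>UNIV. \<Sum>k\<in>{1..k0}. dz (F k) i x * snd v $ i / fval k x)"
        by (rule sum.swap)
      then show ?thesis
        by (simp add: d_def cpair_def log_diff_def add_divide_distrib sum.distrib sum_divide_distrib sum_distrib_right)
    qed
    finally show ?thesis .
  qed
  ultimately show ?thesis by (simp add: fprod_def[abs_def] fval_def)
qed

lemma fprod_eq_0_iff: "fprod k0 F x = 0 \<longleftrightarrow> (\<exists>k\<in>{1..k0}. fval k x = 0)"
  by (simp add: fprod_def fval_def)

lemma level_tangent_space:
  assumes "fprod k0 F x \<noteq> 0" "v \<in> tangent_space {y. fprod k0 F y = fprod k0 F x} x"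
  shows "cpair (log_diff x) v = 0"
proof -
  have "fprod k0 F x * cpair (log_diff x) v = 0"
    by (rule tangent_space_derivative[OF fprod_has_derivative _ assms(2)]) (use assms(1) fprod_eq_0_iff in auto)
  then show ?thesis using assms(1) by simp
qed

text \<open>Coordinates and functions that are constant on the stratum have differentials vanishing
  on \<open>v\<close>, which is what \<open>limit_conormal\<close> asks for. The limit hyperplane
  \<open>T\<close> lies in the kernel of the limit covector and has the same dimension, so it equals
  that kernel, which contains \<open>v\<close>.\<close>

lemma thom_condition_at:
  assumes p: "p \<in> toric_stratum k0 F I K" and K: "K \<noteq> {}" "K \<subseteq> {1..k0}"
    and small: "norm (fst p) < \<epsilon>" "(\<Sum>i\<in>UNIV. (norm (snd p $ i))\<^sup>2) < R"
    and reg: "\<And>K. K \<subseteq> {1..k0} \<Longrightarrow> regular_at K p"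
    and x: "x \<longlonglongrightarrow> p" "\<And>m. fprod k0 F (x m) \<noteq> 0"
    and T: "T \<in> grassmannian_hyp"
    and conv: "subspaces_converge (\<lambda>m. tangent_space {y. fprod k0 F y = fprod k0 F (x m)} (x m)) T"
    and v: "v \<in> tangent_space (toric_stratum k0 F I K \<inter> U) p"
  shows "v \<in> T"
proof -
  obtain \<tau> q where pq: "p = (\<tau>, q)" by (cases p)
  have qI: "q $ i = 0 \<longleftrightarrow> i \<notin> I" for i using p by (simp add: toric_stratum_def pq)
  have fK: "fval k p = 0 \<longleftrightarrow> k \<in> K" if "k \<in> {1..k0}" for k
    using p that by (simp add: toric_stratum_def pq fval_def)
  obtain kz where kz: "kz \<in> {1..k0}" "fval kz (\<tau>, q) = 0" using K fK pq by blast
  have v0: "snd v $ i = 0" if "q $ i = 0" for i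
  proof (rule tangent_space_derivative[OF _ _ v])
    show "((\<lambda>y. snd y $ i) has_derivative (\<lambda>y. snd y $ i)) (at p)"
      by (rule bounded_linear.has_derivative[OF bounded_linear_compose[OF bounded_linear_vec_nth bounded_linear_snd] has_derivative_ident])
    show "snd y $ i = snd p $ i" if "y \<in> toric_stratum k0 F I K \<inter> U" for y
    proof -
      have "snd y $ i = 0" using that qI[of i] \<open>q $ i = 0\<close> by (auto simp: toric_stratum_def)
      then show ?thesis using \<open>q $ i = 0\<close> by (simp add: pq)
    qed
  qed
  have vk: "cpair (dt (F k) (\<tau>, q), \<chi> i. dz (F k) i (\<tau>, q)) v = 0" if k: "k \<in> {1..k0}" "fval k (\<tau>, q) = 0" for k
  proof (rule tangent_space_derivative[OF _ _ v])
    show "(fval k has_derivative cpair (dt (F k) (\<tau>, q), \<chi> i. dz (F k) i (\<tau>, q))) (at p)"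
      unfolding pq by (rule fval_has_derivative[OF k(1)])
    show "fval k y = fval k p" if "y \<in> toric_stratum k0 F I K \<inter> U" for y
      using that k fK[OF k(1)] by (auto simp: toric_stratum_def pq fval_def)
  qed
  have fx: "fval k (x m) \<noteq> 0" if "k \<in> {1..k0}" for k m using x(2)[of m] that by (auto simp: fprod_eq_0_iff)
  obtain r a and M :: "nat \<Rightarrow> real" where r: "strict_mono (r :: nat \<Rightarrow> nat)" and a: "a \<noteq> 0" and M: "\<And>m. M m > 0"
    and lim: "(\<lambda>m. (1 / M m) *\<^sub>R log_diff (x (r m))) \<longlonglongrightarrow> a" and av: "cpair a v = 0"
    by (rule limit_conormal[OF x(1)[unfolded pq] small[unfolded pq fst_conv snd_conv] fx reg[unfolded pq] kz v0 vk],
        assumption+, rule that, assumption+)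
  have sub: "T \<subseteq> {v. cpair a v = 0}"
  proof
    fix y assume y: "y \<in> T"
    show "y \<in> {v. cpair a v = 0}"
    proof (cases "y = 0")
      case True
      then show ?thesis by (simp add: cpair_def)
    next
      case False
      define e where "e = (1 / norm y) *\<^sub>R y"
      have e: "e \<in> T" "norm e = 1" using T y False by (auto simp: e_def grassmannian_hyp_def subspace_mul)
      have "0 \<in> tangent_space {y. fprod k0 F y = fprod k0 F (x m)} (x m)" for m
        by (rule zero_in_tangent_space) simp
      from subspaces_converge_approx[OF conv this e] obtain g
        where g: "\<And>m. g m \<in> tangent_space {y. fprod k0 F y = fprod k0 F (x m)} (x m)" "g \<longlonglongrightarrow> e" by blast
      \<comment> \<open>The hyperplanes converge along the full sequence, so the approximating
        vectors may be restricted to the subsequence \<open>r\<close> on which the covectors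
        converge.\<close>
      have "cpair ((1 / M m) *\<^sub>R log_diff (x (r m))) (g (r m)) = 0" for m
        using level_tangent_space[OF x(2) g(1), of "r m"] by (simp add: cpair_scaleR)
      moreover have "(\<lambda>m. cpair ((1 / M m) *\<^sub>R log_diff (x (r m))) (g (r m))) \<longlonglongrightarrow> cpair a e"
        using LIMSEQ_subseq_LIMSEQ[OF g(2) r] by (intro tendsto_cpair lim) (simp add: o_def)
      ultimately have "cpair a e = 0" by (simp add: LIMSEQ_const_iff)
      then show ?thesis using False by (simp add: e_def cpair_scaleR)
    qed
  qed
  have "T = {v. cpair a v = 0}"
    using T sub dim_cpair_kernel[OF a]
    by (intro subspace_dim_equal subspace_cpair_kernel) (auto simp: grassmannian_hyp_def)
  then show ?thesis using av by simp
qed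

end

theorem theorem4p1:
  fixes k0 :: nat and F :: "nat \<Rightarrow> 'n::finite tzpoly"
  assumes "k0 \<ge> 1"
    and "\<forall>k\<in>{1..k0}. is_tzpoly (F k)"
    and "\<forall>k\<in>{1..k0}. \<exists>x y. tzeval (F k) x \<noteq> tzeval (F k) y"
    and "\<forall>k\<in>{1..k0}. \<forall>t. tzeval (F k) (t, 0) = 0"
    and "newton_admissible k0 F"
  shows "\<exists>U. open U \<and> (0, 0) \<in> U \<and>
    (\<forall>I K. K \<noteq> {} \<and> K \<subseteq> {1..k0} \<longrightarrow>
      (\<forall>p \<in> toric_stratum k0 F I K \<inter> U.
        \<forall>x :: nat \<Rightarrow> complex \<times> (complex^'n). \<forall>T.
          (\<forall>m. x m \<in> U \<and> fprod k0 F (x m) \<noteq> 0) \<and> x \<longlonglongrightarrow> p \<and>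
          T \<in> grassmannian_hyp \<and>
          subspaces_converge (\<lambda>m. tangent_space {y. fprod k0 F y = fprod k0 F (x m)} (x m)) T
          \<longrightarrow> tangent_space (toric_stratum k0 F I K \<inter> U) p \<subseteq> T))"
proof -
  obtain R \<epsilon> where R: "R > 0" and eps: "\<epsilon> > 0" and adm: "\<And>t. cmod t < \<epsilon> \<Longrightarrow>
        (\<forall>k\<in>{1..k0}. newton_boundary (slice (F k) t) = newton_boundary (slice (F k) 0)) \<and>
        (\<forall>K. K \<noteq> {} \<and> K \<subseteq> {1..k0} \<longrightarrow>
            nondegenerate K (\<lambda>k. slice (F k) t) \<and>
            (\<exists>R'. R' > R \<and> tame_radius K (\<lambda>k. slice (F k) t) R'))"
    using assms(5) unfolding newton_admissible_def by blast
  interpret newton_family k0 F R \<epsilon>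
  proof
    show "\<exists>R'>R. tame_radius K (\<lambda>k. slice (F k) t) R'" if "cmod t < \<epsilon>" "K \<noteq> {}" "K \<subseteq> {1..k0}" for K t
      using adm[OF that(1)] that(2,3) by blast
    show "nondegenerate K (\<lambda>k. slice (F k) t)" if "cmod t < \<epsilon>" "K \<noteq> {}" "K \<subseteq> {1..k0}" for K t
      using adm[OF that(1)] that(2,3) by blast
    show "newton_boundary (slice (F k) t) = newton_boundary (slice (F k) 0)" if "k \<in> {1..k0}" "cmod t < \<epsilon>" for k t
      using adm[OF that(2)] that(1) by blast
  qed (use assms eps in auto)
  \<comment> \<open>There are finitely many subsets \<open>K\<close>, so one neighbourhood gives
    regularity for all of them.\<close>
  have "eventually (\<lambda>x. \<forall>K\<in>Pow {1..k0}. regular_at K x) (nhds (0, 0))"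
    by (intro eventually_ball_finite ballI eventually_regular) auto
  then obtain S where S: "open S" "(0, 0) \<in> S" "\<And>x K. x \<in> S \<Longrightarrow> K \<subseteq> {1..k0} \<Longrightarrow> regular_at K x"
    unfolding eventually_nhds by blast
  \<comment> \<open>Three conditions: regularity for every \<open>K\<close>, parameters in the disc
    where admissibility holds, and points within the uniform radius of tameness.\<close>
  define U where "U = S \<inter> {x. norm (fst x) < \<epsilon>} \<inter> {x :: complex \<times> (complex^'n). (\<Sum>i\<in>UNIV. (norm (snd x $ i))\<^sup>2) < R}"
  have "open U" unfolding U_def
    by (intro open_Int S(1) open_Collect_less continuous_intros)
  moreover have "(0, 0) \<in> U" using S(2) R eps by (simp add: U_def)
  moreover have "tangent_space (toric_stratum k0 F I K \<inter> U) p \<subseteq> T"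
    if "K \<noteq> {}" "K \<subseteq> {1..k0}" "p \<in> toric_stratum k0 F I K \<inter> U" "\<And>m. fprod k0 F (x m) \<noteq> 0" "x \<longlonglongrightarrow> p"
      "T \<in> grassmannian_hyp" "subspaces_converge (\<lambda>m. tangent_space {y. fprod k0 F y = fprod k0 F (x m)} (x m)) T"
    for I K p T and x :: "nat \<Rightarrow> complex \<times> (complex^'n)"
  proof
    fix v assume "v \<in> tangent_space (toric_stratum k0 F I K \<inter> U) p"
    moreover have "p \<in> U" using that(3) by blast
    ultimately show "v \<in> T"
      using that(3) S(3)
      by (intro thom_condition_at[OF _ that(1,2) _ _ _ that(5,4,6,7)]) (auto simp: U_def)
  qed
  ultimately show ?thesis by (intro exI[of _ U]) blast
qed

end
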